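(* Let $J=\left(\frac{\partial\mathbb H}{\partial a_0},\dots,\frac{\partial\mathbb H}{\partial a_5}\right)\subseteq R=\mathbf C[a_0,\dots,a_5]$ be the Jacobian ideal of the Hermite invariant $\mathbb H$ of binary quintics. Then $J=\mathfrak b_{\tau}$ for $\tau=(1/6,\,2/45,\,-1/3)$.
   Context: The base field is $\mathbf C$. For binary forms $A,B$ in $x_1,x_2$ of orders (homogeneous degrees) $m,n$ the $r$-th transvectant is $$(A,B)_r=\frac{(m-r)!\,(n-r)!}{m!\,n!}\sum_{i=0}^r(-1)^i\binom ri\frac{\partial^rA}{\partial x_1^{r-i}\partial x_2^i}\,\frac{\partial^rB}{\partial x_1^i\partial x_2^{r-i}},$$ and $(A,B)_r=0$ if $r>\min(m,n)$. $\mathbb F=\sum_{i=0}^5\binom5i a_i x_1^{5-i}x_2^i$ is the generic binary quintic and $R=\mathbf C[a_0,\dots,a_5]$. The covariants used are $\vartheta_{22}=(\mathbb F,\mathbb F)_4$, $\vartheta_{26}=(\mathbb F,\mathbb F)_2$, $\vartheta_{33}=(\vartheta_{22},\mathbb F)_2$, $\vartheta_{39}=(\mathbb F,\vartheta_{26})_1$, $\vartheta_{40}=(\vartheta_{22},\vartheta_{22})_2$, $\vartheta_{51}=(\vartheta_{22}^2,\mathbb F)_4$, $\vartheta_{80}=(\vartheta_{22}^3,\vartheta_{26})_6$. The Hermite invariant is the degree $18$ invariant $\mathbb H=(\vartheta_{22}^7,\ \mathbb F\,\vartheta_{39})_{14}\in R$. The Wronskian of binary forms $A_1,\dots,A_m$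 of order $n$ (with $m\le n+1$) is $W(A_1,\dots,A_m)=\det\big(\partial^{m-1}A_i/\partial x_1^{m-j}\partial x_2^{j-1}\big)_{1\le i,j\le m}$. For $\tau=(\alpha,\beta,\gamma)\in\mathbf Q^3$ put $\mathcal U=\vartheta_{33}\vartheta_{22}-\alpha\,\vartheta_{40}\,\mathbb F$, $\mathcal V=\vartheta_{51}\vartheta_{22}^2-\beta\,\vartheta_{40}^2\,\mathbb F-\gamma\,\vartheta_{80}\,\mathbb F$, and $\Gamma_\tau=W\big((x_1^2,\mathbb F)_1,(x_1x_2,\mathbb F)_1,(x_2^2,\mathbb F)_1,\mathcal U,\mathcal V\big)$, a form of order $5$ in $x_1,x_2$ with coefficients of degree $17$ in the $a_i$. $\mathfrak b_\tau\subseteq R$ is the ideal generated by the coefficients of $\Gamma_\tau$. *)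

theory Defs
  imports
    Complex_Main
    "HOL-Library.Poly_Mapping"
    "HOL-Library.Numeral_Type"
    "Jordan_Normal_Form.Determinant"
begin

section \<open>Polynomials and ideals\<close>

text \<open>A monomial is its exponent vector, and a polynomial is its finitely supported
  coefficient function.\<close>

type_synonym ('v, 'a) mpoly = "('v \<Rightarrow>\<^sub>0 nat) \<Rightarrow>\<^sub>0 'a"

definition Const :: "'a \<Rightarrow> ('v, 'a::zero) mpoly" where
  "Const c = Poly_Mapping.single 0 c"

definition Var :: "'v \<Rightarrow> ('v, 'a::zero_neq_one) mpoly" where
  "Var v = Poly_Mapping.single (Poly_Mapping.single v 1) 1"

text \<open>The truncated subtraction in the exponent is harmless: a monomial not involving
  \<open>v\<close> gets coefficient 0.\<close>

definition pdiff :: "'v \<Rightarrow> ('v, 'a::comm_semiring_1) mpoly \<Rightarrow> ('v, 'a) mpoly" where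
  "pdiff v p = (\<Sum>m\<in>Poly_Mapping.keys p.
     Poly_Mapping.single (m - Poly_Mapping.single v 1)
       (of_nat (Poly_Mapping.lookup m v) * Poly_Mapping.lookup p m))"

text \<open>Ideals of a commutative ring are its submodules as a module over itself.\<close>

lemma module_times: "Modules.module ((*) :: 'a::comm_ring_1 \<Rightarrow> 'a \<Rightarrow> 'a)"
  by unfold_locales (simp_all add: algebra_simps)

definition ideal_generated :: "'a::comm_ring_1 set \<Rightarrow> 'a set" where
  "ideal_generated S = Modules.module.span (*) S"


section \<open>Binary forms, transvectants and Wronskians\<close>

text \<open>\<open>coeff_ring\<close> is \<open>R = \<complex>[a\<^sub>0, \<dots>, a\<^sub>5]\<close>, the variable \<open>a\<^sub>i\<close> being indexed by
  \<open>of_nat i :: 6\<close>; binary forms live in \<open>R[x\<^sub>1, x\<^sub>2]\<close>.\<close>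

type_synonym coeff_ring = "(6, complex) mpoly"

datatype xvar = X1 | X2

type_synonym form = "(xvar, coeff_ring) mpoly"

abbreviation x1 :: form where "x1 \<equiv> Var X1"
abbreviation x2 :: form where "x2 \<equiv> Var X2"

definition scalar :: "complex \<Rightarrow> form" where
  "scalar c = Const (Const c)"

definition pdiff12 :: "nat \<Rightarrow> nat \<Rightarrow> form \<Rightarrow> form" where
  "pdiff12 i j A = (pdiff X1 ^^ i) ((pdiff X2 ^^ j) A)"

text \<open>\<open>transvectant m n r A B\<close> is \<open>(A, B)\<^sub>r\<close> for forms \<open>A\<close> of order \<open>m\<close> and \<open>B\<close> of
  order \<open>n\<close>. The orders are explicit arguments, to be supplied correctly at each use.\<close>

definition transvectant :: "nat \<Rightarrow> nat \<Rightarrow> nat \<Rightarrow> form \<Rightarrow> form \<Rightarrow> form" where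
  "transvectant m n r A B =
    (if r > min m n then 0
     else scalar (fact (m - r) * fact (n - r) / (fact m * fact n)) *
       (\<Sum>i\<le>r. (-1) ^ i * of_nat (r choose i) * pdiff12 (r - i) i A * pdiff12 i (r - i) B))"

text \<open>Rows and columns are numbered from 0, so the usual exponents
  \<open>(m - j, j - 1)\<close> become \<open>(m - 1 - j, j)\<close>.\<close>

definition wronskian :: "form list \<Rightarrow> form" where
  "wronskian As = (let m = length As in
     det (mat m m (\<lambda>(i, j). pdiff12 (m - 1 - j) j (As ! i))))"


section \<open>The generic quintic and its covariants\<close>

definition quintic :: form where
  "quintic = (\<Sum>i\<le>5. of_nat (5 choose i) * Const (Var (of_nat i)) * x1 ^ (5 - i) * x2 ^ i)"

text \<open>The covariants have orders 2 (\<open>th22\<close>), 6 (\<open>th26\<close>), 3 (\<open>th33\<close>), 9 (\<open>th39\<close>),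
  0 (\<open>th40\<close>), 1 (\<open>th51\<close>) and 0 (\<open>th80\<close>).\<close>

definition th22 :: form where "th22 = transvectant 5 5 4 quintic quintic"
definition th26 :: form where "th26 = transvectant 5 5 2 quintic quintic"
definition th33 :: form where "th33 = transvectant 2 5 2 th22 quintic"
definition th39 :: form where "th39 = transvectant 5 6 1 quintic th26"
definition th40 :: form where "th40 = transvectant 2 2 2 th22 th22"
definition th51 :: form where "th51 = transvectant 4 5 4 (th22 ^ 2) quintic"
definition th80 :: form where "th80 = transvectant 6 6 6 (th22 ^ 3) th26"

text \<open>This transvectant has order 0, i.e. it is a constant of \<open>R[x\<^sub>1, x\<^sub>2]\<close>; taking its
  constant coefficient turns it into an element of \<open>R\<close>.\<close>

definition hermite_invariant :: coeff_ring where
  "hermite_invariant =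
     Poly_Mapping.lookup (transvectant 14 14 14 (th22 ^ 7) (quintic * th39)) 0"

definition jacobian_ideal :: "coeff_ring \<Rightarrow> coeff_ring set" where
  "jacobian_ideal h = ideal_generated {pdiff i h | i. i \<in> UNIV}"


section \<open>The ideals generated by the coefficients of the Wronskians\<close>

definition U_form :: "rat \<Rightarrow> form" where
  "U_form \<alpha> = th33 * th22 - scalar (of_rat \<alpha>) * th40 * quintic"

definition V_form :: "rat \<Rightarrow> rat \<Rightarrow> form" where
  "V_form \<beta> \<gamma> = th51 * th22 ^ 2 - scalar (of_rat \<beta>) * th40 ^ 2 * quintic
     - scalar (of_rat \<gamma>) * th80 * quintic"

fun Gamma_form :: "rat \<times> rat \<times> rat \<Rightarrow> form" where
  "Gamma_form (\<alpha>, \<beta>, \<gamma>) = wronskian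
     [transvectant 2 5 1 (x1 ^ 2) quintic,
      transvectant 2 5 1 (x1 * x2) quintic,
      transvectant 2 5 1 (x2 ^ 2) quintic,
      U_form \<alpha>,
      V_form \<beta> \<gamma>]"

definition b_ideal :: "rat \<times> rat \<times> rat \<Rightarrow> coeff_ring set" where
  "b_ideal \<tau> = ideal_generated {Poly_Mapping.lookup (Gamma_form \<tau>) m | m. m \<in> UNIV}"

end

theory Submission
  imports Defs
begin

text \<open>Write \<open>F\<close> for the quintic, \<open>H\<close> for the Hermite invariant, \<open>h\<^sub>d\<close> for \<open>\<partial>H/\<partial>a\<^sub>d\<close>, and \<open>U\<close>, \<open>V\<close> for the two
forms of order 5 that enter the Wronskian \<open>\<Gamma>\<close>. The two ideals agree because their generators agree
up to nonzero constants: the coefficient of \<open>x\<^sub>1\<^sup>5\<^sup>-\<^sup>k x\<^sub>2\<^sup>k\<close> in \<open>\<Gamma>\<close> is a constant times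
\<open>(-1)\<^sup>k h\<^sub>5\<^sub>-\<^sub>k\<close>. In other words \<open>\<Gamma>\<close> is a multiple of the evectant of \<open>H\<close>, the covariant of order 5
formed from the partial derivatives of \<open>H\<close>.

Both sides are covariants, and a covariant is determined by its leading coefficient. Only a single
infinitesimal transformation is needed to exploit this, the shear \<open>x\<^sub>2 \<mapsto> x\<^sub>2 + t x\<^sub>1\<close>. It acts on \<open>R\<close>
by the derivation \<open>raise\<close> with \<open>a\<^sub>k \<mapsto> (5 - k) a\<^sub>k\<^sub>+\<^sub>1\<close>. A form built from \<open>F\<close> by transvectants and products is
annihilated by \<open>shear\<close>, the difference of the actions on coefficients and on variables
(\<open>shear_transvectant\<close>, a telescoping sum); so applying \<open>raise\<close> to one coefficient of the form yields
the next one. For the invariant \<open>H\<close> this says \<open>raise H = 0\<close>, and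
commuting \<open>raise\<close> past \<open>\<partial>/\<partial>a\<^sub>d\<close> shows that \<open>raise\<close> carries \<open>h\<^sub>d\<^sub>+\<^sub>1\<close> to a multiple of
\<open>h\<^sub>d\<close> (\<open>raise_pdiff\<close>). On the other side, fourth derivatives of quintic forms are linear forms, and
expanding the Wronskian shows that the coefficients of \<open>\<Gamma>\<close> are the maximal minors of the
5 by 6 matrix of coefficients of the five forms (\<open>wronskian_bform\<close>). Here, too, \<open>raise\<close> carries each
minor to a multiple of the next (\<open>raise_gamma_minor\<close>), because the three forms \<open>(x\<^sub>i x\<^sub>j, F)\<^sub>1\<close> span an
invariant space, while \<open>U\<close> and \<open>V\<close> are invariant themselves.

It remains to compare the leading coefficients, that is, to prove one identity between polynomials of
degree 17 in \<open>a\<^sub>0, \<dots>, a\<^sub>5\<close> (\<open>leading_coefficient\<close>). It is checked by expansion, and it is here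
that the particular values \<open>1/6\<close>, \<open>2/45\<close>, \<open>-1/3\<close> of the parameters matter. The coefficients of
the covariants are multiplied by suitable integers beforehand, so that no denominators occur.\<close>

section \<open>Derivations of polynomial rings\<close>

lemma mpoly_induct [case_names monomial add]:
  fixes P :: "('m::monoid_add \<Rightarrow>\<^sub>0 'a::comm_monoid_add) \<Rightarrow> bool"
  assumes monomial: "\<And>m c. P (Poly_Mapping.single m c)"
    and add: "\<And>p q. P p \<Longrightarrow> P q \<Longrightarrow> P (p + q)"
  shows "P p"
proof (induction p rule: update_induct)
  case const
  show ?case using monomial[of 0 0] by simp
next
  case (update p m c)
  have "Poly_Mapping.update m c p = p + Poly_Mapping.single m c"
    by (rule poly_mapping_eqI)
      (use update in \<open>auto simp: lookup_update lookup_add lookup_single in_keys_iff when_def\<close>)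
  then show ?case using add update monomial by simp
qed

locale derivation =
  fixes d :: "'a::comm_ring_1 \<Rightarrow> 'a"
  assumes add: "d (x + y) = d x + d y"
    and mult: "d (x * y) = d x * y + x * d y"
begin

lemma zero: "d 0 = 0"
  using add[of 0 0] by simp

lemma one: "d 1 = 0"
  using mult[of 1 1] by simp

lemma uminus: "d (- x) = - d x"
  using add[of x "- x"] zero by (simp add: eq_neg_iff_add_eq_0 add.commute)

lemma diff: "d (x - y) = d x - d y"
  using add[of x "- y"] by (simp add: uminus)

lemma of_nat: "d (of_nat n) = 0"
  by (induction n) (simp_all add: zero one add)

lemma numeral: "d (numeral w) = 0"
  using of_nat[of "numeral w"] by simp

lemma power: "d (x ^ n) = of_nat n * x ^ (n - 1) * d x"
proof (induction n)
  case (Suc n)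
  then show ?case by (cases n) (simp_all add: mult algebra_simps)
qed (simp add: one)

lemma sum: "d (sum f S) = (\<Sum>x\<in>S. d (f x))"
  by (induction S rule: infinite_finite_induct) (simp_all add: zero add)

lemmas rules = zero one add uminus diff of_nat numeral mult power sum

end

lemma pdiff_single:
  "pdiff v (Poly_Mapping.single m c) =
    Poly_Mapping.single (m - Poly_Mapping.single v 1) (of_nat (Poly_Mapping.lookup m v) * c)"
  by (simp add: pdiff_def)

lemma pdiff_add: "pdiff v (p + q) = pdiff v p + pdiff v q"
  unfolding pdiff_def
  by (rule setsum_keys_plus_distrib) (simp_all add: single_add algebra_simps)

lemma derivation_pdiff: "derivation (pdiff v)"
proof
  fix p q :: "('a, 'b) mpoly"
  have shift: "m + n - Poly_Mapping.single v 1 = (m - Poly_Mapping.single v 1) + n"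
    if "Poly_Mapping.lookup m v \<noteq> 0" for m n :: "'a \<Rightarrow>\<^sub>0 nat"
    by (rule poly_mapping_eqI) (use that in \<open>auto simp: lookup_add lookup_minus lookup_single when_def\<close>)
  have half: "Poly_Mapping.single (m + n - Poly_Mapping.single v 1) (of_nat (Poly_Mapping.lookup m v) * (a * b)) =
      pdiff v (Poly_Mapping.single m a) * Poly_Mapping.single n b"
    for m n :: "'a \<Rightarrow>\<^sub>0 nat" and a b :: 'b
    by (cases "Poly_Mapping.lookup m v = 0")
      (simp_all add: pdiff_single mult_single shift mult.assoc del: One_nat_def)
  have monomials: "pdiff v (Poly_Mapping.single m a * Poly_Mapping.single n b) =
      pdiff v (Poly_Mapping.single m a) * Poly_Mapping.single n b +
      Poly_Mapping.single m a * pdiff v (Poly_Mapping.single n b)"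
    for m n :: "'a \<Rightarrow>\<^sub>0 nat" and a b :: 'b
    using half[of m n a b] half[of n m b a]
    by (simp add: pdiff_single[of v "m + n"] mult_single[of m] lookup_add distrib_right single_add
        add.commute[of n m] mult.commute[of b a] mult.commute[of _ "Poly_Mapping.single m a"])
  have "pdiff v (Poly_Mapping.single m a * q) =
      pdiff v (Poly_Mapping.single m a) * q + Poly_Mapping.single m a * pdiff v q" for m a
    by (induction q rule: mpoly_induct) (simp_all add: monomials pdiff_add algebra_simps)
  then show "pdiff v (p * q) = pdiff v p * q + p * pdiff v q"
    by (induction p rule: mpoly_induct) (simp_all add: pdiff_add algebra_simps)
qed (rule pdiff_add)

interpretation pdiff: derivation "pdiff v" for v
  by (rule derivation_pdiff)

lemma pdiff_commute: "pdiff v (pdiff w p) = pdiff w (pdiff v p)"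
proof (induction p rule: mpoly_induct)
  case (monomial m c)
  have *: "m - Poly_Mapping.single v 1 - Poly_Mapping.single w 1 =
      m - Poly_Mapping.single w 1 - Poly_Mapping.single v 1"
    by (rule poly_mapping_eqI) (simp add: lookup_minus)
  show ?case
    by (cases "v = w") (simp_all add: pdiff_single * lookup_minus lookup_single algebra_simps)
qed (simp add: pdiff_add)

lemma Const_add: "Const (a + b) = Const a + Const b"
  by (simp add: Const_def single_add)

lemma Const_diff: "Const (a - b) = Const a - Const b"
  by (simp add: Const_def single_diff)

lemma Const_uminus: "Const (- a) = - Const a"
  by (simp add: Const_def single_uminus)

lemma Const_mult: "Const (a * b) = Const a * Const b"
  by (simp add: Const_def mult_single)

lemma Const_0: "Const 0 = 0"
  by (simp add: Const_def)

lemma Const_1: "Const 1 = 1"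
  by (simp add: Const_def)

lemma Const_of_nat: "Const (of_nat n) = of_nat n"
  by (induction n) (simp_all add: Const_0 Const_1 Const_add)

lemma Const_numeral: "Const (numeral w) = numeral w"
  using Const_of_nat[of "numeral w"] by simp

lemma Const_power: "Const (a ^ n) = Const a ^ n"
  by (induction n) (simp_all add: Const_1 Const_mult)

lemma Const_sum: "Const (sum f S) = (\<Sum>x\<in>S. Const (f x))"
  by (induction S rule: infinite_finite_induct) (simp_all add: Const_0 Const_add)

lemmas Const_hom = Const_0 Const_1 Const_numeral Const_of_nat Const_add Const_diff Const_uminus
  Const_mult Const_power Const_sum

lemma Const_lookup_0: "Poly_Mapping.lookup (Const c) 0 = c"
  by (simp add: Const_def)

lemma pdiff_Const [simp]: "pdiff v (Const c) = 0"
  by (simp add: Const_def pdiff_single)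

lemma pdiff_Var: "pdiff v (Var w) = (if v = w then 1 else 0)"
  by (simp add: Var_def pdiff_single lookup_single flip: single_one)

definition coeffwise :: "('a \<Rightarrow> 'a) \<Rightarrow> ('v, 'a::comm_ring_1) mpoly \<Rightarrow> ('v, 'a) mpoly" where
  "coeffwise d p = (\<Sum>m\<in>Poly_Mapping.keys p. Poly_Mapping.single m (d (Poly_Mapping.lookup p m)))"

context derivation
begin

lemma coeffwise_single: "coeffwise d (Poly_Mapping.single m c) = Poly_Mapping.single m (d c)"
  by (simp add: coeffwise_def zero)

lemma coeffwise_add: "coeffwise d (p + q) = coeffwise d p + coeffwise d q"
  unfolding coeffwise_def
  by (rule setsum_keys_plus_distrib) (simp_all add: zero add single_add)

lemma derivation_coeffwise: "derivation (coeffwise d)"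
proof
  fix p q :: "('v, 'a) mpoly"
  have "coeffwise d (Poly_Mapping.single m a * q) =
      coeffwise d (Poly_Mapping.single m a) * q + Poly_Mapping.single m a * coeffwise d q" for m a
    by (induction q rule: mpoly_induct)
      (simp_all add: coeffwise_single coeffwise_add mult_single mult single_add algebra_simps)
  then show "coeffwise d (p * q) = coeffwise d p * q + p * coeffwise d q"
    by (induction p rule: mpoly_induct) (simp_all add: coeffwise_add algebra_simps)
qed (rule coeffwise_add)

lemma coeffwise_Const: "coeffwise d (Const c) = Const (d c)"
  by (simp add: Const_def coeffwise_single)

lemma coeffwise_Var: "coeffwise d (Var v) = 0"
  by (simp add: Var_def coeffwise_single one)

lemma coeffwise_pdiff: "coeffwise d (pdiff v p) = pdiff v (coeffwise d p)"
  by (induction p rule: mpoly_induct)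
    (simp_all add: pdiff_single coeffwise_single coeffwise_add pdiff_add mult of_nat)

end

section \<open>Invariance under shears\<close>

text \<open>The first-order change of the coefficients of the quintic under the substitution
\<open>x\<^sub>2 \<mapsto> x\<^sub>2 + t x\<^sub>1\<close>: this derivation sends \<open>a\<^sub>i\<close> to \<open>(5 - i) a\<^sub>i\<^sub>+\<^sub>1\<close>.\<close>

definition raise :: "coeff_ring \<Rightarrow> coeff_ring" where
  "raise p = (\<Sum>i<5. of_nat (5 - i) * Var (of_nat (Suc i)) * pdiff (of_nat i) p)"

text \<open>The same substitution changes a form with constant coefficients by \<open>x\<^sub>1 \<partial>A/\<partial>x\<^sub>2\<close> to first
order. Hence \<open>shear\<close> measures by how much \<open>A\<close> fails to be covariant under the substitution.\<close>

definition shear :: "form \<Rightarrow> form" where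
  "shear A = coeffwise raise A - x1 * pdiff X2 A"

interpretation raise: derivation raise
proof
  show "raise (p + q) = raise p + raise q" for p q
    by (simp only: raise_def pdiff.add distrib_left sum.distrib)
  show "raise (p * q) = raise p * q + p * raise q" for p q
    by (simp only: raise_def pdiff.mult distrib_left sum.distrib sum_distrib_left sum_distrib_right
        mult_ac add_ac)
qed

interpretation coeffwise_raise: derivation "coeffwise raise"
  by (rule raise.derivation_coeffwise)

interpretation shear: derivation shear
  by standard (simp_all add: shear_def coeffwise_raise.add coeffwise_raise.mult pdiff.add pdiff.mult
      algebra_simps)

lemma shear_pdiff_X2: "shear (pdiff X2 A) = pdiff X2 (shear A)"
  by (simp add: shear_def raise.coeffwise_pdiff pdiff.diff pdiff.mult pdiff_Var)

text \<open>The substitution fixes \<open>x\<^sub>1\<close>, so \<open>shear\<close> commutes with \<open>\<partial>/\<partial>x\<^sub>2\<close>, while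
\<open>\<partial>/\<partial>x\<^sub>1\<close> picks up an extra term.\<close>

lemma shear_pdiff_X1: "shear (pdiff X1 A) = pdiff X1 (shear A) + pdiff X2 A"
  by (simp add: shear_def raise.coeffwise_pdiff pdiff.diff pdiff.mult pdiff_Var
      pdiff_commute[of X1 X2])

lemma pdiff12_Suc_left: "pdiff12 (Suc i) j A = pdiff X1 (pdiff12 i j A)"
  by (simp add: pdiff12_def)

lemma pdiff12_Suc_right: "pdiff12 i (Suc j) A = pdiff X2 (pdiff12 i j A)"
proof -
  have "(pdiff X1 ^^ i) (pdiff X2 B) = pdiff X2 ((pdiff X1 ^^ i) B)" for B :: form
    by (induction i) (simp_all add: pdiff_commute[of X1 X2])
  then show ?thesis by (simp add: pdiff12_def)
qed

lemma shear_pdiff12: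
  assumes "shear A = 0"
  shows "shear (pdiff12 i j A) = of_nat i * pdiff12 (i - 1) (Suc j) A"
proof (induction i)
  case 0
  show ?case
    by (induction j) (simp_all add: assms pdiff12_Suc_right shear_pdiff_X2 pdiff.rules, simp add: pdiff12_def assms)
next
  case (Suc i)
  have "pdiff X1 (of_nat i * pdiff12 (i - 1) (Suc j) A) = of_nat i * pdiff12 i (Suc j) A"
    by (cases i) (simp_all add: pdiff.rules pdiff12_Suc_left)
  then show ?case
    by (simp add: pdiff12_Suc_left shear_pdiff_X1 Suc pdiff12_Suc_right algebra_simps)
qed

lemma shear_scalar: "shear (scalar c) = 0"
proof -
  have "raise (Const c) = 0" by (simp add: raise_def)
  then show ?thesis by (simp add: shear_def scalar_def raise.coeffwise_Const Const_0)
qed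

text \<open>In the transvectant, shearing a derivative of \<open>A\<close> trades one \<open>\<partial>/\<partial>x\<^sub>1\<close> for one
\<open>\<partial>/\<partial>x\<^sub>2\<close>, and likewise for \<open>B\<close>. The two kinds of terms so obtained belong to neighbouring
summands and cancel in pairs, because of the alternating signs and
\<open>(r - i) (r choose i) = (i + 1) (r choose (i + 1))\<close>.\<close>

lemma shear_transvectant:
  assumes A: "shear A = 0" and B: "shear B = 0"
  shows "shear (transvectant m n r A B) = 0"
proof (cases "r \<le> min m n")
  case True
  define t :: "nat \<Rightarrow> form" where "t i = (-1) ^ i * of_nat (r choose i) *
      pdiff12 (r - i) i A * pdiff12 i (r - i) B" for i
  \<comment> \<open>The part of \<open>shear (t i)\<close> in which \<open>B\<close> is sheared; the part in which \<open>A\<close> is sheared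
    is \<open>- s (Suc i)\<close>.\<close>
  define s :: "nat \<Rightarrow> form" where "s i = (-1) ^ i * of_nat ((r choose i) * i) *
      pdiff12 (r - i) i A * pdiff12 (i - 1) (r - i + 1) B" for i
  have "shear (t i) = s i - s (Suc i)" if "i \<le> r" for i
  proof -
    have *: "(r choose i) * (r - i) = (r choose Suc i) * Suc i"
      using binomial_absorb_comp[of r i] Suc_times_binomial_eq[of "r - 1" i]
      by (cases r) (auto simp: algebra_simps)
    have 1: "pdiff12 (r - Suc i) (Suc i) A * pdiff12 i (r - i) B * of_nat ((r choose i) * (r - i)) =
      pdiff12 (r - Suc i) (Suc i) A * pdiff12 i (Suc (r - Suc i)) B * of_nat ((r choose Suc i) * Suc i)"
      unfolding * by (cases "i = r") (simp_all add: Suc_diff_Suc that le_neq_implies_less binomial_eq_0)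
    have "shear (t i) = s i + (-1) ^ i *
        (pdiff12 (r - Suc i) (Suc i) A * pdiff12 i (r - i) B * of_nat ((r choose i) * (r - i)))"
      by (simp add: t_def s_def shear.rules shear_pdiff12[OF A] shear_pdiff12[OF B]
          distrib_left mult_ac del: of_nat_diff)
    also have "\<dots> = s i - s (Suc i)"
      unfolding 1 by (simp add: s_def algebra_simps)
    finally show ?thesis .
  qed
  then have "shear (\<Sum>i\<le>r. t i) = (\<Sum>i\<le>r. s i - s (Suc i))"
    by (simp add: shear.sum)
  also have "\<dots> = s 0 - s (Suc r)"
    by (induction r) simp_all
  also have "\<dots> = 0"
    by (simp add: s_def binomial_eq_0)
  finally show ?thesis
    using True by (simp add: transvectant_def shear.mult shear.zero shear_scalar t_def)
qed (simp add: transvectant_def shear.zero del: min.bounded_iff)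

lemma of_nat_6_eq_iff: "i < 6 \<Longrightarrow> j < 6 \<Longrightarrow> (of_nat i :: 6) = of_nat j \<longleftrightarrow> i = j"
proof -
  assume "i < 6" "j < 6"
  then have "i \<in> {0,1,2,3,4,5}" "j \<in> {0,1,2,3,4,5}" by auto
  then show ?thesis by auto
qed

lemma raise_Var: "i < 5 \<Longrightarrow> raise (Var (of_nat i)) = of_nat (5 - i) * Var (of_nat (Suc i))"
  by (simp add: raise_def pdiff_Var of_nat_6_eq_iff if_distrib cong: if_cong)

lemma raise_Var_5: "raise (Var 5) = 0"
  using of_nat_6_eq_iff[of _ 5] by (simp add: raise_def pdiff_Var)

lemma UNIV_6: "(UNIV :: 6 set) = of_nat ` {..<6}"
proof -
  have "card ((of_nat :: nat \<Rightarrow> 6) ` {..<6}) = 6"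
    by (subst card_image) (auto simp: inj_on_def of_nat_6_eq_iff)
  then show ?thesis
    by (intro card_subset_eq[symmetric]) auto
qed

section \<open>Binary forms in terms of their coefficients\<close>

text \<open>Two normalizations of coefficients are used. With binomial coefficients attached, differentiation is
a mere shift of the coefficient sequence, so this is the natural one for transvectants and for
\<open>shear\<close>. Without them, multiplication of forms is the convolution of the coefficient
sequences, without denominators.\<close>

definition bform :: "nat \<Rightarrow> (nat \<Rightarrow> coeff_ring) \<Rightarrow> form" where
  "bform m A = (\<Sum>k\<le>m. of_nat (m choose k) * Const (A k) * x1 ^ (m - k) * x2 ^ k)"

definition pform :: "nat \<Rightarrow> (nat \<Rightarrow> coeff_ring) \<Rightarrow> form" where
  "pform m A = (\<Sum>k\<le>m. Const (A k) * x1 ^ (m - k) * x2 ^ k)"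

lemma bform_eq_pform: "bform m A = pform m (\<lambda>k. of_nat (m choose k) * A k)"
  by (simp add: bform_def pform_def Const_mult Const_of_nat)

lemma pdiff_X1_bform: "pdiff X1 (bform (Suc m) A) = of_nat (Suc m) * bform m A"
proof -
  have "pdiff X1 (bform (Suc m) A) =
      (\<Sum>k\<le>Suc m. of_nat ((Suc m choose k) * (Suc m - k)) * Const (A k) * x1 ^ (m - k) * x2 ^ k)"
    by (simp add: bform_def pdiff.rules pdiff_Var mult_ac
        del: sum.atMost_Suc of_nat_diff of_nat_Suc binomial_Suc_Suc)
  also have "\<dots> = (\<Sum>k\<le>m. of_nat ((Suc m choose k) * (Suc m - k)) * Const (A k) * x1 ^ (m - k) * x2 ^ k)"
    by simp
  also have "\<dots> = of_nat (Suc m) * bform m A"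
    unfolding bform_def sum_distrib_left
  proof (intro sum.cong refl)
    fix k assume "k \<in> {..m}"
    then have "(Suc m choose k) * (Suc m - k) = Suc m * (m choose k)"
      using binomial_absorb_comp[of "Suc m" k] by (simp add: algebra_simps)
    then show "of_nat ((Suc m choose k) * (Suc m - k)) * Const (A k) * x1 ^ (m - k) * x2 ^ k =
        of_nat (Suc m) * (of_nat (m choose k) * Const (A k) * x1 ^ (m - k) * x2 ^ k)"
      by (simp only: of_nat_mult mult.assoc)
  qed
  finally show ?thesis .
qed

lemma pdiff_X2_bform: "pdiff X2 (bform (Suc m) A) = of_nat (Suc m) * bform m (\<lambda>k. A (Suc k))"
proof -
  have "pdiff X2 (bform (Suc m) A) =
      (\<Sum>k\<le>Suc m. of_nat ((Suc m choose k) * k) * Const (A k) * x1 ^ (Suc m - k) * x2 ^ (k - 1))"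
    by (simp add: bform_def pdiff.rules pdiff_Var mult_ac
        del: sum.atMost_Suc of_nat_diff of_nat_Suc binomial_Suc_Suc)
  also have "\<dots> = (\<Sum>k\<le>m. of_nat ((Suc m choose Suc k) * Suc k) * Const (A (Suc k)) * x1 ^ (m - k) * x2 ^ k)"
    by (subst sum.atMost_Suc_shift) simp
  also have "\<dots> = of_nat (Suc m) * bform m (\<lambda>k. A (Suc k))"
    unfolding bform_def sum_distrib_left
  proof (intro sum.cong refl)
    fix k
    have "(Suc m choose Suc k) * Suc k = Suc m * (m choose k)"
      by (simp only: Suc_times_binomial_eq)
    then show "of_nat ((Suc m choose Suc k) * Suc k) * Const (A (Suc k)) * x1 ^ (m - k) * x2 ^ k =
        of_nat (Suc m) * (of_nat (m choose k) * Const (A (Suc k)) * x1 ^ (m - k) * x2 ^ k)"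
      by (simp only: of_nat_mult mult.assoc)
  qed
  finally show ?thesis .
qed

lemma scalar_mult: "scalar c * scalar d = scalar (c * d)"
  by (simp add: scalar_def Const_mult)

lemma scalar_of_nat: "scalar (of_nat n) = of_nat n"
  by (simp add: scalar_def Const_of_nat)

lemma pdiff_scalar: "pdiff v (scalar c * A) = scalar c * pdiff v A"
  by (simp add: scalar_def pdiff.mult)

lemma pdiff12_bform:
  "pdiff12 i j (bform (n + i + j) A) = scalar (fact (n + i + j) / fact n) * bform n (\<lambda>k. A (k + j))"
proof (induction i arbitrary: n)
  case 0
  show ?case
  proof (induction j arbitrary: n)
    case 0
    show ?case by (simp add: pdiff12_def scalar_def Const_1)
  next
    case (Suc j)
    have "pdiff12 0 (Suc j) (bform (n + 0 + Suc j) A) =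
        scalar (fact (Suc n + j) / fact (Suc n)) * pdiff X2 (bform (Suc n) (\<lambda>k. A (k + j)))"
      using Suc[of "Suc n"] by (simp add: pdiff12_Suc_right pdiff_scalar)
    also have "\<dots> = scalar (fact (Suc n + j) / fact (Suc n) * of_nat (Suc n)) * bform n (\<lambda>k. A (k + Suc j))"
      by (simp only: pdiff_X2_bform scalar_mult[symmetric] scalar_of_nat mult.assoc add_Suc_right add_Suc)
    also have "fact (Suc n + j) / fact (Suc n) * of_nat (Suc n) = (fact (n + 0 + Suc j) / fact n :: complex)"
      by (simp del: of_nat_Suc)
    finally show ?case .
  qed
next
  case (Suc i)
  have "pdiff12 (Suc i) j (bform (n + Suc i + j) A) =
      scalar (fact (Suc n + i + j) / fact (Suc n)) * pdiff X1 (bform (Suc n) (\<lambda>k. A (k + j)))"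
    using Suc[of "Suc n"] by (simp add: pdiff12_Suc_left pdiff_scalar)
  also have "\<dots> = scalar (fact (Suc n + i + j) / fact (Suc n) * of_nat (Suc n)) * bform n (\<lambda>k. A (k + j))"
    by (simp only: pdiff_X1_bform scalar_mult[symmetric] scalar_of_nat mult.assoc)
  also have "fact (Suc n + i + j) / fact (Suc n) * of_nat (Suc n) = (fact (n + Suc i + j) / fact n :: complex)"
    by (simp del: of_nat_Suc)
  finally show ?case .
qed

text \<open>The normalizing factor of the transvectant cancels exactly against the factorials produced by the
derivatives of the two forms.\<close>

lemma transvectant_bform:
  assumes "r \<le> m" "r \<le> n"
  shows "transvectant m n r (bform m A) (bform n B) =
    (\<Sum>i\<le>r. (-1) ^ i * of_nat (r choose i) * bform (m - r) (\<lambda>k. A (k + i)) * bform (n - r) (\<lambda>k. B (k + (r - i))))"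
proof -
  let ?c = "fact (m - r) * fact (n - r) / (fact m * fact n) :: complex"
  have "scalar ?c * ((-1) ^ i * of_nat (r choose i) * pdiff12 (r - i) i (bform m A) * pdiff12 i (r - i) (bform n B)) =
      (-1) ^ i * of_nat (r choose i) * bform (m - r) (\<lambda>k. A (k + i)) * bform (n - r) (\<lambda>k. B (k + (r - i)))"
    if "i \<le> r" for i
  proof -
    have "m = (m - r) + (r - i) + i" "n = (n - r) + i + (r - i)"
      using assms that by auto
    then have A: "pdiff12 (r - i) i (bform m A) = scalar (fact m / fact (m - r)) * bform (m - r) (\<lambda>k. A (k + i))"
      and B: "pdiff12 i (r - i) (bform n B) = scalar (fact n / fact (n - r)) * bform (n - r) (\<lambda>k. B (k + (r - i)))"
      using pdiff12_bform[of "r - i" i "m - r" A] pdiff12_bform[of i "r - i" "n - r" B] by simp_all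
    have cancel: "scalar ?c * scalar (fact m / fact (m - r)) * scalar (fact n / fact (n - r)) = 1"
      by (simp add: scalar_mult) (simp add: scalar_def Const_1)
    have scale_cancel: "scalar ?c * (s * b * (scalar (fact m / fact (m - r)) * N) *
        (scalar (fact n / fact (n - r)) * N')) = s * b * N * N'" for s b N N'
    proof -
      have "c * (s * b * (p * N) * (q * N')) = (c * p * q) * (s * b * N * N')" for c p q :: form
        by (simp only: mult_ac)
      then show ?thesis by (simp only: cancel mult_1)
    qed
    show ?thesis
      unfolding A B
      by (rule scale_cancel)
  qed
  then show ?thesis
    using assms by (simp add: transvectant_def sum_distrib_left)
qed

lemma shear_bform: "shear (bform m A) = bform m (\<lambda>k. raise (A k) - of_nat (m - k) * A (Suc k))"
proof -
  have "coeffwise raise (bform m A) = bform m (\<lambda>k. raise (A k))"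
    by (simp add: bform_def coeffwise_raise.rules raise.coeffwise_Const raise.coeffwise_Var)
  moreover have "x1 * pdiff X2 (bform m A) = bform m (\<lambda>k. of_nat (m - k) * A (Suc k))"
  proof (cases m)
    case 0
    then show ?thesis by (simp add: bform_def pdiff.rules Const_0)
  next
    case (Suc n)
    have absorb: "Suc n * (n choose k) = (m choose k) * (m - k)" for k
      using binomial_absorb_comp[of m k] Suc by (simp only: diff_Suc_1 mult.commute)
    have "x1 * pdiff X2 (bform m A) =
        (\<Sum>k\<le>n. of_nat (Suc n * (n choose k)) * Const (A (Suc k)) * x1 ^ (m - k) * x2 ^ k)"
      unfolding Suc pdiff_X2_bform
      by (simp add: bform_def sum_distrib_left Suc_diff_le algebra_simps)
    also have "\<dots> = (\<Sum>k\<le>n. of_nat ((m choose k) * (m - k)) * Const (A (Suc k)) * x1 ^ (m - k) * x2 ^ k)"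
      by (simp only: absorb)
    also have "\<dots> = bform m (\<lambda>k. of_nat (m - k) * A (Suc k))"
      by (simp add: bform_def Suc Const_hom mult_ac del: of_nat_diff)
    finally show ?thesis .
  qed
  ultimately show ?thesis
    by (simp add: shear_def bform_def Const_diff right_diff_distrib left_diff_distrib sum_subtractf)
qed

lemma lookup_pform:
  "Poly_Mapping.lookup (pform m A) e =
    (if Poly_Mapping.lookup e X1 + Poly_Mapping.lookup e X2 = m
     then A (Poly_Mapping.lookup e X2) else 0)"
proof -
  define mon :: "nat \<Rightarrow> nat \<Rightarrow> xvar \<Rightarrow>\<^sub>0 nat" where
    "mon i j = Poly_Mapping.single X1 i + Poly_Mapping.single X2 j" for i j
  have Var_power: "Var v ^ i = (Poly_Mapping.single (Poly_Mapping.single v i) 1 :: form)" for v i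
    by (induction i) (simp_all add: Var_def mult_single flip: single_add)
  have single_term: "Const c * x1 ^ i * x2 ^ j = Poly_Mapping.single (mon i j) c" for c i j
    by (simp only: Const_def Var_power mult_single mon_def add_0 mult_1_right)
  have mon: "mon i j = e \<longleftrightarrow> i = Poly_Mapping.lookup e X1 \<and> j = Poly_Mapping.lookup e X2" for i j
  proof
    assume "mon i j = e"
    then show "i = Poly_Mapping.lookup e X1 \<and> j = Poly_Mapping.lookup e X2"
      by (auto simp: mon_def lookup_add lookup_single)
  next
    assume "i = Poly_Mapping.lookup e X1 \<and> j = Poly_Mapping.lookup e X2"
    then have "Poly_Mapping.lookup (mon i j) v = Poly_Mapping.lookup e v" for v
      by (cases v) (auto simp: mon_def lookup_add lookup_single)
    then show "mon i j = e" by (rule poly_mapping_eqI)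
  qed
  have "Poly_Mapping.lookup (pform m A) e =
      (\<Sum>k\<le>m. if k = Poly_Mapping.lookup e X2 \<and> m - k = Poly_Mapping.lookup e X1 then A k else 0)"
    unfolding pform_def single_term lookup_sum lookup_single mon when_def by (intro sum.cong refl if_cong) auto
  also have "\<dots> = (\<Sum>k\<le>m. if k = Poly_Mapping.lookup e X2 then
      (if m - k = Poly_Mapping.lookup e X1 then A k else 0) else 0)"
    by (intro sum.cong refl) auto
  also have "\<dots> = (if Poly_Mapping.lookup e X2 \<le> m then
      (if m - Poly_Mapping.lookup e X2 = Poly_Mapping.lookup e X1
       then A (Poly_Mapping.lookup e X2) else 0) else 0)"
    by (simp add: sum.delta)
  finally show ?thesis
    by (auto simp: le_imp_diff_is_add)
qed

lemma lookup_bform: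
  "Poly_Mapping.lookup (bform m A) e =
    (if Poly_Mapping.lookup e X1 + Poly_Mapping.lookup e X2 = m
     then of_nat (m choose Poly_Mapping.lookup e X2) * A (Poly_Mapping.lookup e X2) else 0)"
  by (simp add: bform_eq_pform lookup_pform)

text \<open>Comparing coefficients in \<open>shear (bform m A) = 0\<close>: in a covariant form every coefficient arises
from the preceding one.\<close>

lemma covariant_coeffs:
  assumes "shear (bform m A) = 0" "k \<le> m"
  shows "raise (A k) = of_nat (m - k) * A (Suc k)"
proof -
  let ?e = "Poly_Mapping.single X1 (m - k) + Poly_Mapping.single X2 k"
  have e: "Poly_Mapping.lookup ?e X1 = m - k" "Poly_Mapping.lookup ?e X2 = k"
    by (simp_all add: lookup_add lookup_single)
  have "Poly_Mapping.lookup (shear (bform m A)) ?e = of_nat (m choose k) * (raise (A k) - of_nat (m - k) * A (Suc k))"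
    using assms(2) by (simp add: shear_bform lookup_bform e del: of_nat_diff)
  moreover have "of_nat (m choose k) \<noteq> (0 :: coeff_ring)"
    using assms(2) by simp
  ultimately show ?thesis using assms(1) by simp
qed

lemma pform_mult:
  "pform m A * pform n B = pform (m + n) (\<lambda>k. \<Sum>j\<le>k. if j \<le> m \<and> k - j \<le> n then A j * B (k - j) else 0)"
proof -
  define c where "c i j = Const (A i * B j) * x1 ^ (m + n - (i + j)) * x2 ^ (i + j)" for i j
  have "pform m A * pform n B = (\<Sum>i\<le>m. \<Sum>j\<le>n. c i j)"
    unfolding pform_def sum_product
  proof (intro sum.cong refl)
    fix i j assume "i \<in> {..m}" "j \<in> {..n}"
    then have "x1 ^ (m + n - (i + j)) = x1 ^ (m - i) * x1 ^ (n - j)"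
      by (simp flip: power_add)
    then show "Const (A i) * x1 ^ (m - i) * x2 ^ i * (Const (B j) * x1 ^ (n - j) * x2 ^ j) = c i j"
      by (simp add: c_def Const_mult power_add mult_ac)
  qed
  also have "\<dots> = (\<Sum>(i, j)\<in>{..m} \<times> {..n}. c i j)"
    by (simp add: sum.cartesian_product)
  also have "\<dots> = (\<Sum>(k, i)\<in>{(k, i) \<in> SIGMA k:{..m + n}. {..k}. i \<le> m \<and> k - i \<le> n}. c i (k - i))"
    by (rule sum.reindex_bij_witness[of _ "\<lambda>(k, i). (i, k - i)" "\<lambda>(i, j). (i + j, i)"]) auto
  also have "\<dots> = (\<Sum>(k, i)\<in>(SIGMA k:{..m + n}. {..k}). if i \<le> m \<and> k - i \<le> n then c i (k - i) else 0)"
    by (rule sum.mono_neutral_cong_left) (auto split: if_splits)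
  also have "\<dots> = (\<Sum>k\<le>m + n. \<Sum>i\<le>k. if i \<le> m \<and> k - i \<le> n then c i (k - i) else 0)"
    by (simp add: sum.Sigma)
  also have "\<dots> = pform (m + n) (\<lambda>k. \<Sum>j\<le>k. if j \<le> m \<and> k - j \<le> n then A j * B (k - j) else 0)"
    unfolding pform_def c_def
    by (intro sum.cong refl) (auto simp: Const_sum sum_distrib_right Const_0 intro!: sum.cong)
  finally show ?thesis .
qed

lemma pform_eq_bform: "pform m A = bform m (\<lambda>k. Const (1 / of_nat (m choose k)) * A k)"
proof -
  have "of_nat (m choose k) * Const (Const (1 / of_nat (m choose k))) = (1 :: form)" if "k \<le> m" for k
    using that by (simp add: scalar_mult flip: scalar_def scalar_of_nat) (simp add: scalar_def Const_1)
  then show ?thesis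
    unfolding pform_def bform_def by (intro sum.cong refl) (simp add: Const_mult flip: mult.assoc)
qed

lemma transvectant_pform:
  "transvectant m m m (pform m A) (pform m B) =
    Const (\<Sum>i\<le>m. (-1) ^ i * Const (1 / of_nat (m choose i)) * A i * B (m - i))"
proof -
  have *: "of_nat (m choose i) * Const (Const (1 / of_nat (m choose i))) = (1 :: form)" if "i \<le> m" for i
    using that by (simp add: scalar_mult flip: scalar_def scalar_of_nat) (simp add: scalar_def Const_1)
  have "transvectant m m m (pform m A) (pform m B) = (\<Sum>i\<le>m. (-1) ^ i * of_nat (m choose i) *
      Const (Const (1 / of_nat (m choose i)) * A i) * Const (Const (1 / of_nat (m choose (m - i))) * B (m - i)))"
    unfolding pform_eq_bform by (simp add: transvectant_bform) (simp add: bform_def)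
  also have "\<dots> = (\<Sum>i\<le>m. Const ((-1) ^ i * Const (1 / of_nat (m choose i)) * A i * B (m - i)))"
  proof (intro sum.cong refl)
    fix i assume "i \<in> {..m}"
    then have i: "i \<le> m" by simp
    show "(-1) ^ i * of_nat (m choose i) * Const (Const (1 / of_nat (m choose i)) * A i) *
        (Const (Const (1 / of_nat (m choose (m - i))) * B (m - i)) :: form) =
        Const ((-1) ^ i * Const (1 / of_nat (m choose i)) * A i * B (m - i))"
    proof -
      let ?k = "Const (Const (1 / of_nat (m choose i))) :: form"
      have "(-1) ^ i * of_nat (m choose i) * (?k * Const (A i)) * (?k * Const (B (m - i))) =
          (of_nat (m choose i) * ?k) * ((-1) ^ i * ?k * Const (A i) * Const (B (m - i)))"
        by (simp only: mult_ac)
      then have "(-1) ^ i * of_nat (m choose i) * (?k * Const (A i)) * (?k * Const (B (m - i))) =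
          (-1) ^ i * ?k * Const (A i) * Const (B (m - i))"
        by (simp only: *[OF i] mult_1_left)
      then show ?thesis
        by (simp only: Const_mult Const_power Const_uminus Const_1 binomial_symmetric[OF i, symmetric])
    qed
  qed
  finally show ?thesis by (simp add: Const_sum)
qed

lemma pdiff12_numeral: "pdiff12 i j (numeral w * A) = numeral w * pdiff12 i j A"
proof -
  have "(pdiff v ^^ i) (numeral w * B) = numeral w * (pdiff v ^^ i) B" for v i and B :: form
    by (induction i) (simp_all add: pdiff.mult pdiff.numeral)
  then show ?thesis by (simp add: pdiff12_def)
qed

lemma transvectant_numeral_left: "transvectant m n r (numeral w * A) B = numeral w * transvectant m n r A B"
  by (simp add: transvectant_def pdiff12_numeral sum_distrib_left) (simp add: mult_ac)

lemma transvectant_numeral_right: "transvectant m n r A (numeral w * B) = numeral w * transvectant m n r A B"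
  by (simp add: transvectant_def pdiff12_numeral sum_distrib_left) (simp add: mult_ac)

lemma numeral_mult_scalar: "numeral w * (scalar c * A) = scalar (numeral w * c) * A"
  by (simp add: scalar_def Const_hom mult_ac)

lemma bform_divide: "numeral w * A = bform m f \<Longrightarrow> A = bform m (\<lambda>k. Const (1 / numeral w) * f k)"
proof -
  assume A: "numeral w * A = bform m f"
  have "numeral w * Const (Const (1 / numeral w)) = (1 :: form)"
    by (simp add: Const_1 flip: Const_numeral Const_mult)
  then have "A = numeral w * Const (Const (1 / numeral w)) * A"
    by simp
  also have "\<dots> = Const (Const (1 / numeral w)) * (numeral w * A)"
    by (simp only: mult_ac)
  also have "\<dots> = bform m (\<lambda>k. Const (1 / numeral w) * f k)"
    unfolding A by (simp add: bform_def sum_distrib_left Const_mult mult_ac)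
  finally show ?thesis .
qed

lemmas form_expand = bform_def pform_def eval_nat_numeral Const_hom

section \<open>The covariants of the quintic\<close>

text \<open>Any linear order on the two variables will do: it makes the ring of forms an instance of the class of
integral domains, where polynomial identities can be decided by normalization.\<close>

instantiation xvar :: linorder
begin

definition "less_eq_xvar a b \<longleftrightarrow> a = X1 \<or> b = X2"

definition "less_xvar a b \<longleftrightarrow> a = X1 \<and> b = X2"

instance
  by standard (auto simp: less_eq_xvar_def less_xvar_def intro: xvar.exhaust)

end

abbreviation a0 :: coeff_ring where "a0 \<equiv> Var 0"
abbreviation a1 :: coeff_ring where "a1 \<equiv> Var 1"
abbreviation a2 :: coeff_ring where "a2 \<equiv> Var 2"
abbreviation a3 :: coeff_ring where "a3 \<equiv> Var 3"
abbreviation a4 :: coeff_ring where "a4 \<equiv> Var 4"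
abbreviation a5 :: coeff_ring where "a5 \<equiv> Var 5"

definition quintic_coeffs :: "coeff_ring list" where
  "quintic_coeffs = [a0, a1, a2, a3, a4, a5]"

text \<open>Half the coefficients of \<open>th22\<close>, which is \<open>2 (j\<^sub>0 x\<^sub>1\<^sup>2 + j\<^sub>1 x\<^sub>1 x\<^sub>2 + j\<^sub>2 x\<^sub>2\<^sup>2)\<close>.\<close>

definition j0 :: coeff_ring where "j0 = a0*a4 - 4*a1*a3 + 3*a2^2"
definition j1 :: coeff_ring where "j1 = a0*a5 - 3*a1*a4 + 2*a2*a3"
definition j2 :: coeff_ring where "j2 = a1*a5 - 4*a2*a4 + 3*a3^2"

definition disc :: coeff_ring where "disc = 4*j0*j2 - j1^2"

text \<open>The sequences below belong to \<open>10 th26\<close>, \<open>th39\<close>, \<open>th33 / 2\<close>, \<open>3 th22\<^sup>2\<close> and \<open>3 th51\<close>; all of them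
except the one of \<open>th39\<close> are in the binomial normalization. The multiples are chosen to make the
entries integral.\<close>

definition th26_coeffs :: "coeff_ring list" where
  "th26_coeffs =
   [20*a0*a2 - 20*a1^2,
    10*a0*a3 - 10*a1*a2,
    4*a0*a4 + 4*a1*a3 - 8*a2^2,
    a0*a5 + 7*a1*a4 - 8*a2*a3,
    4*a1*a5 + 4*a2*a4 - 8*a3^2,
    10*a2*a5 - 10*a3*a4,
    20*a3*a5 - 20*a4^2]"

definition th39_coeffs :: "coeff_ring list" where
  "th39_coeffs =
   [a0^2*a3 - 3*a0*a1*a2 + 2*a1^3,
    2*a0^2*a4 + a0*a1*a3 - 12*a0*a2^2 + 9*a1^2*a2,
    a0^2*a5 + 11*a0*a1*a4 - 34*a0*a2*a3 + 16*a1^2*a3 + 6*a1*a2^2,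
    7*a0*a1*a5 - 8*a0*a2*a4 - 34*a0*a3^2 + 29*a1^2*a4 - 2*a1*a2*a3 + 8*a2^3,
    5*a0*a2*a5 - 40*a0*a3*a4 + 16*a1^2*a5 + 47*a1*a2*a4 - 44*a1*a3^2 + 16*a2^2*a3,
    - 5*a0*a3*a5 - 16*a0*a4^2 + 40*a1*a2*a5 - 47*a1*a3*a4 + 44*a2^2*a4 - 16*a2*a3^2,
    - 7*a0*a4*a5 + 8*a1*a3*a5 - 29*a1*a4^2 + 34*a2^2*a5 + 2*a2*a3*a4 - 8*a3^3,
    - a0*a5^2 - 11*a1*a4*a5 + 34*a2*a3*a5 - 16*a2*a4^2 - 6*a3^2*a4,
    - 2*a1*a5^2 - a2*a4*a5 + 12*a3^2*a5 - 9*a3*a4^2,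
    - a2*a5^2 + 3*a3*a4*a5 - 2*a4^3]"

definition th33_coeffs :: "coeff_ring list" where
  "th33_coeffs = [j0*a2 - j1*a1 + j2*a0, j0*a3 - j1*a2 + j2*a1, j0*a4 - j1*a3 + j2*a2, j0*a5 - j1*a4 + j2*a3]"

definition th22_sq_coeffs :: "coeff_ring list" where
  "th22_sq_coeffs = [12*j0^2, 6*j0*j1, 2*j1^2 + 4*j0*j2, 6*j1*j2, 12*j2^2]"

definition th51_coeffs :: "coeff_ring list" where
  "th51_coeffs = (let B = (!) th22_sq_coeffs in
    [B 0*a4 - 4*B 1*a3 + 6*B 2*a2 - 4*B 3*a1 + B 4*a0,
     B 0*a5 - 4*B 1*a4 + 6*B 2*a3 - 4*B 3*a2 + B 4*a1])"

text \<open>The invariant \<open>5 th80 / 4\<close>; the factors of the entries of \<open>th26_coeffs\<close> are the coefficients of the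
cube of \<open>j\<^sub>0 x\<^sub>1\<^sup>2 + j\<^sub>1 x\<^sub>1 x\<^sub>2 + j\<^sub>2 x\<^sub>2\<^sup>2\<close> with alternating signs.\<close>

definition e80 :: coeff_ring where
  "e80 = (let s = (!) th26_coeffs in
     j0^3*s 6 - 3*j0^2*j1*s 5 + 3*(j0^2*j2 + j0*j1^2)*s 4 - (6*j0*j1*j2 + j1^3)*s 3
     + 3*(j0*j2^2 + j1^2*j2)*s 2 - 3*j1*j2^2*s 1 + j2^3*s 0)"

lemma quintic_eq_bform: "quintic = bform 5 ((!) quintic_coeffs)"
proof -
  have "quintic_coeffs ! k = Var (of_nat k)" if "k \<le> 5" for k
  proof -
    have "k \<in> {0,1,2,3,4,5}" using that by auto
    then show ?thesis by (auto simp: quintic_coeffs_def)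
  qed
  then show ?thesis by (simp add: quintic_def bform_def)
qed

lemma th22_eq: "th22 = bform 2 ((!) [2*j0, j1, 2*j2])"
proof -
  have "th22 = (\<Sum>i\<le>4. (-1) ^ i * of_nat (4 choose i) *
      bform 1 (\<lambda>k. quintic_coeffs ! (k + i)) * bform 1 (\<lambda>k. quintic_coeffs ! (k + (4 - i))))"
    by (simp add: th22_def quintic_eq_bform transvectant_bform)
  also have "\<dots> = bform 2 ((!) [2*j0, j1, 2*j2])"
    by (simp add: bform_def eval_nat_numeral Const_hom quintic_coeffs_def j0_def j1_def j2_def,
        Groebner_Basis.algebra)
  finally show ?thesis .
qed

lemma th33_eq: "th33 = 2 * bform 3 ((!) th33_coeffs)"
  unfolding th33_def th22_eq quintic_eq_bform
  by (simp add: transvectant_bform,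
      simp add: form_expand quintic_coeffs_def th33_coeffs_def,
      Groebner_Basis.algebra)

lemma th40_eq: "th40 = Const (2 * disc)"
  unfolding th40_def th22_eq
  by (simp add: transvectant_bform,
      simp add: form_expand disc_def)

lemma th26_eq: "10 * th26 = bform 6 ((!) th26_coeffs)"
  unfolding th26_def quintic_eq_bform
  by (simp add: transvectant_bform,
      simp add: form_expand quintic_coeffs_def th26_coeffs_def,
      Groebner_Basis.algebra)

lemma th39_eq: "th39 = pform 9 ((!) th39_coeffs)"
proof -
  have "10 * th39 = transvectant 5 6 1 quintic (bform 6 ((!) th26_coeffs))"
    by (simp add: th39_def transvectant_numeral_right flip: th26_eq)
  also have "\<dots> = 10 * pform 9 ((!) th39_coeffs)"
    unfolding quintic_eq_bform
    by (simp add: transvectant_bform,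
        simp add: form_expand quintic_coeffs_def th26_coeffs_def th39_coeffs_def,
        Groebner_Basis.algebra)
  finally show ?thesis by simp
qed

lemma th22_sq_eq: "3 * th22 ^ 2 = bform 4 ((!) th22_sq_coeffs)"
  unfolding th22_eq
  by (simp add: form_expand th22_sq_coeffs_def,
      Groebner_Basis.algebra)

lemma th51_eq: "3 * th51 = bform 1 ((!) th51_coeffs)"
proof -
  have "3 * th51 = transvectant 4 5 4 (bform 4 ((!) th22_sq_coeffs)) quintic"
    by (simp add: th51_def transvectant_numeral_left flip: th22_sq_eq)
  also have "\<dots> = bform 1 ((!) th51_coeffs)"
    unfolding quintic_eq_bform
    by (simp add: transvectant_bform,
        simp add: form_expand quintic_coeffs_def th51_coeffs_def th22_sq_coeffs_def,
        Groebner_Basis.algebra)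
  finally show ?thesis .
qed

lemma th80_eq: "5 * th80 = Const (4 * e80)"
proof -
  let ?C = "[40*j0^3, 20*j0^2*j1, 8*j0^2*j2 + 8*j0*j1^2, 12*j0*j1*j2 + 2*j1^3,
    8*j0*j2^2 + 8*j1^2*j2, 20*j1*j2^2, 40*j2^3]"
  have cube: "5 * th22 ^ 3 = bform 6 ((!) ?C)"
    unfolding th22_eq
    by (simp add: form_expand,
        Groebner_Basis.algebra)
  have "50 * th80 = transvectant 6 6 6 (5 * th22 ^ 3) (10 * th26)"
    by (simp add: th80_def transvectant_numeral_left transvectant_numeral_right)
  also have "\<dots> = transvectant 6 6 6 (bform 6 ((!) ?C)) (bform 6 ((!) th26_coeffs))"
    by (simp only: cube th26_eq)
  also have "\<dots> = 10 * Const (4 * e80)"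
    by (simp add: transvectant_bform,
        simp add: form_expand e80_def Let_def,
        Groebner_Basis.algebra)
  finally show ?thesis by simp
qed

text \<open>The coefficients of \<open>15 U\<close> and \<open>45 V\<close> for the parameters in question.\<close>

definition U_coeffs :: "coeff_ring list" where
  "U_coeffs = (let c = (!) th33_coeffs in
    [60*j0*c 0 - 5*disc*a0,
     6*(6*j0*c 1 + 2*j1*c 0) - 5*disc*a1,
     6*(3*j0*c 2 + 3*j1*c 1 + j2*c 0) - 5*disc*a2,
     6*(j0*c 3 + 3*j1*c 2 + 3*j2*c 1) - 5*disc*a3,
     6*(2*j1*c 3 + 6*j2*c 2) - 5*disc*a4,
     60*j2*c 3 - 5*disc*a5])"

definition V_coeffs :: "coeff_ring list" where
  "V_coeffs = (let B = (!) th22_sq_coeffs; l = (!) th51_coeffs; f = 12*e80 - 8*disc^2 in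
    [5*l 0*B 0 + f*a0,
     4*l 0*B 1 + l 1*B 0 + f*a1,
     3*l 0*B 2 + 2*l 1*B 1 + f*a2,
     2*l 0*B 3 + 3*l 1*B 2 + f*a3,
     l 0*B 4 + 4*l 1*B 3 + f*a4,
     5*l 1*B 4 + f*a5])"

lemma U_eq: "15 * U_form (1/6) = bform 5 ((!) U_coeffs)"
proof -
  have "15 * (scalar (1/6) * th40) = 5 * Const disc"
    unfolding th40_eq numeral_mult_scalar by (simp add: scalar_def flip: Const_hom mult.assoc)
  then have "15 * U_form (1/6) = 15 * th33 * th22 - 5 * Const disc * quintic"
    by (simp add: U_form_def of_rat_divide algebra_simps)
  also have "\<dots> = bform 5 ((!) U_coeffs)"
    unfolding th33_eq th22_eq quintic_eq_bform
    by (simp add: form_expand quintic_coeffs_def U_coeffs_def Let_def,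
        Groebner_Basis.algebra)
  finally show ?thesis .
qed

lemma V_eq: "45 * V_form (2/45) (-1/3) = bform 5 ((!) V_coeffs)"
proof -
  define x where "x = scalar (2/45) * th40 ^ 2"
  define y where "y = scalar (-1/3) * th80"
  have x: "45 * x = 8 * Const disc ^ 2"
    unfolding x_def th40_eq numeral_mult_scalar
    by (simp add: scalar_def Const_mult Const_numeral power_mult_distrib)
  have "45 * y = - 3 * (5 * th80)"
    unfolding y_def numeral_mult_scalar by (simp add: scalar_def Const_uminus Const_numeral)
  then have y: "45 * y = - 12 * Const e80"
    by (simp only: th80_eq) (simp add: Const_mult Const_numeral)
  have "V_form (2/45) (-1/3) = th51 * th22 ^ 2 - x * quintic - y * quintic"
    by (simp add: V_form_def x_def y_def of_rat_divide of_rat_minus)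
  then have "45 * V_form (2/45) (-1/3) =
      5 * (3 * th51) * (3 * th22 ^ 2) - (45 * x) * quintic - (45 * y) * quintic"
    by (simp add: right_diff_distrib)
  also have "\<dots> = bform 5 ((!) V_coeffs)"
    unfolding x y
    unfolding th51_eq th22_sq_eq quintic_eq_bform
    by (simp add: form_expand quintic_coeffs_def V_coeffs_def Let_def,
        Groebner_Basis.algebra)
  finally show ?thesis .
qed

lemma raise_vars: "raise a0 = 5*a1" "raise a1 = 4*a2" "raise a2 = 3*a3" "raise a3 = 2*a4" "raise a4 = a5" "raise a5 = 0"
  using raise_Var[of 0] raise_Var[of 1] raise_Var[of 2] raise_Var[of 3] raise_Var[of 4] raise_Var_5
  by simp_all

lemma shear_quintic: "shear quintic = 0"
proof -
  have "raise (quintic_coeffs ! k) - of_nat (5 - k) * quintic_coeffs ! Suc k = 0" if "k \<le> 5" for k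
  proof -
    have "k = 0 \<or> k = 1 \<or> k = 2 \<or> k = 3 \<or> k = 4 \<or> k = 5" using that by presburger
    then show ?thesis by (elim disjE) (simp_all add: quintic_coeffs_def raise_vars)
  qed
  then show ?thesis
    unfolding quintic_eq_bform shear_bform unfolding bform_def
    by (intro sum.neutral) (simp add: Const_0 del: of_nat_diff)
qed

lemma shear_covariants:
  "shear th22 = 0" "shear th26 = 0" "shear th33 = 0" "shear th39 = 0" "shear th40 = 0"
  "shear th51 = 0" "shear th80 = 0"
proof -
  show "shear th22 = 0" "shear th26 = 0"
    by (simp_all add: th22_def th26_def shear_transvectant shear_quintic)
  then show "shear th33 = 0" "shear th39 = 0" "shear th40 = 0" "shear th51 = 0" "shear th80 = 0"
    by (simp_all add: th33_def th39_def th40_def th51_def th80_def shear_transvectant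
        shear.power shear_quintic)
qed

lemma shear_U: "shear (U_form \<alpha>) = 0" and shear_V: "shear (V_form \<beta> \<gamma>) = 0"
  by (simp_all add: U_form_def V_form_def shear.rules shear_covariants shear_quintic shear_scalar)

section \<open>The Hermite invariant\<close>

text \<open>The multinomial expansion of \<open>(p x\<^sub>1\<^sup>2 + q x\<^sub>1 x\<^sub>2 + r x\<^sub>2\<^sup>2)\<^sup>7\<close>, of which
\<open>th22\<^sup>7\<close> is \<open>2\<^sup>7\<close> times a special case.\<close>

definition seventh_power_coeffs :: "coeff_ring \<Rightarrow> coeff_ring \<Rightarrow> coeff_ring \<Rightarrow> coeff_ring list" where
  "seventh_power_coeffs p q r =
   [p^7,
    7*p^6*q,
    21*p^5*q^2 + 7*p^6*r,
    35*p^4*q^3 + 42*p^5*q*r,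
    35*p^3*q^4 + 105*p^4*q^2*r + 21*p^5*r^2,
    21*p^2*q^5 + 140*p^3*q^3*r + 105*p^4*q*r^2,
    7*p*q^6 + 105*p^2*q^4*r + 210*p^3*q^2*r^2 + 35*p^4*r^3,
    q^7 + 42*p*q^5*r + 210*p^2*q^3*r^2 + 140*p^3*q*r^3,
    7*q^6*r + 105*p*q^4*r^2 + 210*p^2*q^2*r^3 + 35*p^3*r^4,
    21*q^5*r^2 + 140*p*q^3*r^3 + 105*p^2*q*r^4,
    35*q^4*r^3 + 105*p*q^2*r^4 + 21*p^2*r^5,
    35*q^3*r^4 + 42*p*q*r^5,
    21*q^2*r^5 + 7*p*r^6,
    7*q*r^6,
    r^7]"

lemma seventh_power: "bform 2 ((!) [2*p, q, 2*r]) ^ 7 = 128 * pform 14 ((!) (seventh_power_coeffs p q r))"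
  by (simp add: bform_def pform_def numeral_2_eq_2 Const_hom seventh_power_coeffs_def,
      simp add: eval_nat_numeral seventh_power_coeffs_def Const_hom,
      Groebner_Basis.algebra)

text \<open>The numbers \<open>24024 / (14 choose i)\<close>; the least common multiple of the binomial
coefficients \<open>14 choose i\<close> is 24024.\<close>

definition hermite_weights :: "coeff_ring list" where
  "hermite_weights = [24024, 1716, 264, 66, 24, 12, 8, 7, 8, 12, 24, 66, 264, 1716, 24024]"

lemma hermite_weight_eq:
  assumes "i \<le> 14"
  shows "24024 * Const (1 / of_nat (14 choose i)) = hermite_weights ! i"
proof -
  have "i = 0 \<or> i = 1 \<or> i = 2 \<or> i = 3 \<or> i = 4 \<or> i = 5 \<or> i = 6 \<or> i = 7 \<or>
      i = 8 \<or> i = 9 \<or> i = 10 \<or> i = 11 \<or> i = 12 \<or> i = 13 \<or> i = 14"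
    using assms by presburger
  moreover have "24024 * Const (1 / of_nat (14 choose i)) = (Const (24024 / of_nat (14 choose i)) :: coeff_ring)"
    by (simp flip: Const_mult Const_numeral)
  ultimately show ?thesis
    by (elim disjE)
      (simp_all add: hermite_weights_def binomial_fact fact_numeral Const_numeral Const_1)
qed

text \<open>The transvectant of order 14 that defines \<open>H\<close> pairs the \<open>i\<close>-th coefficient of the seventh power of
\<open>th22 / 2\<close> with the coefficient of index \<open>14 - i\<close> of the product of the quintic and \<open>th39\<close>, which is
the inner sum.\<close>

definition hermite_sum :: coeff_ring where
  "hermite_sum = (\<Sum>i\<le>14. (-1) ^ i * hermite_weights ! i *
     seventh_power_coeffs j0 j1 j2 ! i *
     (\<Sum>j\<le>14 - i. if j \<le> 5 \<and> 14 - i - j \<le> 9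
       then of_nat (5 choose j) * quintic_coeffs ! j * th39_coeffs ! (14 - i - j) else 0))"

lemma hermite_eq:
  shows transvectant_hermite: "transvectant 14 14 14 (th22 ^ 7) (quintic * th39) = Const hermite_invariant"
    and hermite_invariant_eq: "24024 * hermite_invariant = 128 * hermite_sum"
proof -
  define P where "P i = seventh_power_coeffs j0 j1 j2 ! i" for i
  define Q where "Q k = (\<Sum>j\<le>k. if j \<le> 5 \<and> k - j \<le> 9
    then of_nat (5 choose j) * quintic_coeffs ! j * th39_coeffs ! (k - j) else 0)" for k
  define h where "h = (\<Sum>i\<le>14. (-1) ^ i * Const (1 / of_nat (14 choose i)) * P i * Q (14 - i))"
  have "th22 ^ 7 = 128 * pform 14 P" "quintic * th39 = pform 14 Q"
    unfolding th22_eq seventh_power quintic_eq_bform bform_eq_pform[of 5] th39_eq pform_mult P_def Q_def by simp_all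
  then have h: "transvectant 14 14 14 (th22 ^ 7) (quintic * th39) = Const (128 * h)"
    by (simp add: transvectant_numeral_left transvectant_pform h_def Const_mult Const_numeral)
  then show "transvectant 14 14 14 (th22 ^ 7) (quintic * th39) = Const hermite_invariant"
    by (simp add: hermite_invariant_def Const_lookup_0)
  have "24024 * h = (\<Sum>i\<le>14. 24024 * ((-1) ^ i * Const (1 / of_nat (14 choose i)) * P i * Q (14 - i)))"
    unfolding h_def by (rule sum_distrib_left)
  also have "\<dots> = hermite_sum"
    unfolding hermite_sum_def
  proof (intro sum.cong refl)
    fix i :: nat assume "i \<in> {..14}"
    then have *: "24024 * Const (1 / of_nat (14 choose i)) = hermite_weights ! i"
      by (intro hermite_weight_eq) simp
    have "n * (s * k * p * q) = s * (n * k) * p * q" for n s k p q :: coeff_ring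
      by (simp only: mult_ac)
    then show "24024 * ((-1) ^ i * Const (1 / of_nat (14 choose i)) * P i * Q (14 - i)) =
       (-1) ^ i * hermite_weights ! i * seventh_power_coeffs j0 j1 j2 ! i *
       (\<Sum>j\<le>14 - i. if j \<le> 5 \<and> 14 - i - j \<le> 9
         then of_nat (5 choose j) * quintic_coeffs ! j * th39_coeffs ! (14 - i - j) else 0)"
      unfolding *[symmetric] P_def Q_def .
  qed
  finally show "24024 * hermite_invariant = 128 * hermite_sum"
    using h by (simp add: hermite_invariant_def Const_lookup_0)
qed

text \<open>The transvectant has order 0 and is annihilated by \<open>shear\<close>, so \<open>raise\<close> annihilates its only
coefficient.\<close>

lemma raise_hermite: "raise hermite_invariant = 0"
proof -
  have "shear (Const hermite_invariant) = 0"
    unfolding transvectant_hermite[symmetric]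
    by (intro shear_transvectant) (simp_all add: shear.rules shear_covariants shear_quintic)
  then have "Const (raise hermite_invariant) = (0 :: form)"
    by (simp add: shear_def raise.coeffwise_Const)
  then show ?thesis
    by (metis Const_lookup_0 lookup_zero)
qed

text \<open>The commutator of \<open>\<partial>/\<partial>a\<^sub>k\<^sub>+\<^sub>1\<close> and \<open>raise\<close> is \<open>(5 - k) \<partial>/\<partial>a\<^sub>k\<close>, because
\<open>a\<^sub>k\<^sub>+\<^sub>1\<close> occurs in \<open>raise\<close> only as the coefficient of \<open>\<partial>/\<partial>a\<^sub>k\<close>.\<close>

lemma raise_pdiff:
  assumes "k < 5" "raise p = 0"
  shows "raise (pdiff (of_nat (Suc k)) p) = - of_nat (5 - k) * pdiff (of_nat k) p"
proof -
  have "0 = pdiff (of_nat (Suc k)) (raise p)"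
    by (simp add: assms pdiff.zero)
  also have "\<dots> = (\<Sum>i<5. of_nat (5 - i) * (if k = i then 1 else 0) * pdiff (of_nat i) p) +
      raise (pdiff (of_nat (Suc k)) p)"
    unfolding raise_def
    using \<open>k < 5\<close>
    by (simp add: pdiff.sum pdiff.mult pdiff.of_nat pdiff_Var sum.distrib
        pdiff_commute[of "of_nat (Suc k)"] of_nat_6_eq_iff
        del: of_nat_Suc of_nat_diff)
  also have "(\<Sum>i<5. of_nat (5 - i) * (if k = i then 1 else 0) * pdiff (of_nat i) p) =
      of_nat (5 - k) * pdiff (of_nat k) p"
  proof -
    have "(\<Sum>i<5. of_nat (5 - i) * (if k = i then 1 else 0) * pdiff (of_nat i) p) =
        (\<Sum>i<5. if k = i then of_nat (5 - i) * pdiff (of_nat i) p else 0)"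
      by (intro sum.cong) simp_all
    then show ?thesis using \<open>k < 5\<close> by (simp del: of_nat_diff)
  qed
  finally show ?thesis
    by (simp add: eq_neg_iff_add_eq_0 add.commute)
qed

section \<open>The Wronskian as a form of maximal minors\<close>

definition det3 :: "('b \<Rightarrow> 'a::comm_ring_1) \<Rightarrow> ('b \<Rightarrow> 'a) \<Rightarrow> ('b \<Rightarrow> 'a) \<Rightarrow> 'b \<Rightarrow> 'b \<Rightarrow> 'b \<Rightarrow> 'a" where
  "det3 p q r i j k =
     p i * (q j * r k - q k * r j) - p j * (q i * r k - q k * r i) + p k * (q i * r j - q j * r i)"

text \<open>The determinant of the columns \<open>a, b, c, d, e\<close> of a matrix with five rows, in Laplace expansion along
the last two rows: the last two rows will be those of \<open>U\<close> and \<open>V\<close>, whose entries are by far the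
largest.\<close>

definition det5 :: "('b \<Rightarrow> 'a::comm_ring_1) \<Rightarrow> ('b \<Rightarrow> 'a) \<Rightarrow> ('b \<Rightarrow> 'a) \<Rightarrow> ('b \<Rightarrow> 'a) \<Rightarrow> ('b \<Rightarrow> 'a) \<Rightarrow>
    'b \<Rightarrow> 'b \<Rightarrow> 'b \<Rightarrow> 'b \<Rightarrow> 'b \<Rightarrow> 'a" where
  "det5 p q r u v a b c d e = (let D = det3 p q r; M = (\<lambda>i j. u i * v j - u j * v i) in
     M a b * D c d e - M a c * D b d e + M a d * D b c e - M a e * D b c d + M b c * D a d e
     - M b d * D a c e + M b e * D a c d + M c d * D a b e - M c e * D a b d + M d e * D a b c)"

text \<open>The minor of a matrix with columns \<open>0, \<dots>, 5\<close> that omits column \<open>d\<close>.\<close>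

definition maximal_minor :: "(nat \<Rightarrow> 'a::comm_ring_1) \<Rightarrow> (nat \<Rightarrow> 'a) \<Rightarrow> (nat \<Rightarrow> 'a) \<Rightarrow>
    (nat \<Rightarrow> 'a) \<Rightarrow> (nat \<Rightarrow> 'a) \<Rightarrow> nat \<Rightarrow> 'a" where
  "maximal_minor p q r u v d = (let c = (\<lambda>i. if i < d then i else Suc i) in
     det5 p q r u v (c 0) (c 1) (c 2) (c 3) (c 4))"

lemma det_mat_Suc:
  fixes f :: "nat \<times> nat \<Rightarrow> 'a::comm_ring_1"
  shows "det (mat (Suc n) (Suc n) f) =
    (\<Sum>j<Suc n. (-1) ^ j * f (0, j) * det (mat n n (\<lambda>(i, k). f (Suc i, if k < j then k else Suc k))))"
proof -
  have "mat_delete (mat (Suc n) (Suc n) f) 0 j = mat n n (\<lambda>(i, k). f (Suc i, if k < j then k else Suc k))"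
    if "j < Suc n" for j
    using that by (intro eq_matI) (auto simp: mat_delete_def)
  then show ?thesis
    by (subst laplace_expansion_row[of _ "Suc n" 0]) (auto simp: cofactor_def intro!: sum.cong)
qed

lemma det_mat_3:
  fixes f :: "nat \<times> nat \<Rightarrow> 'a::idom"
  shows "det (mat 3 3 f) = det3 (\<lambda>j. f (0, j)) (\<lambda>j. f (1, j)) (\<lambda>j. f (2, j)) 0 1 2"
proof -
  have 2: "det (mat 2 2 g) = g (0, 0) * g (1, 1) - g (0, 1) * g (1, 0)" for g :: "nat \<times> nat \<Rightarrow> 'a"
    by (simp add: numeral_2_eq_2 det_mat_Suc sum.lessThan_Suc)
  have expand: "(\<Sum>j<3. h j) = h 0 + h 1 + h 2" for h :: "nat \<Rightarrow> 'a"
    by (simp add: eval_nat_numeral)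
  show ?thesis
    using det_mat_Suc[of 2 f] by (simp add: 2 expand det3_def numeral_2_eq_2[symmetric])
qed

lemma det_mat_5:
  fixes f :: "nat \<times> nat \<Rightarrow> 'a::idom"
  shows "det (mat 5 5 f) =
    det5 (\<lambda>j. f (0, j)) (\<lambda>j. f (1, j)) (\<lambda>j. f (2, j)) (\<lambda>j. f (3, j)) (\<lambda>j. f (4, j)) 0 1 2 3 4"
proof -
  have expand4: "(\<Sum>j<4. h j) = h 0 + h 1 + h 2 + h 3" for h :: "nat \<Rightarrow> 'a"
    by (simp add: eval_nat_numeral)
  have expand5: "(\<Sum>j<5. h j) = h 0 + h 1 + h 2 + h 3 + h 4" for h :: "nat \<Rightarrow> 'a"
    by (simp add: eval_nat_numeral)
  have 4: "det (mat 4 4 g) =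
      (\<Sum>j<4. (-1) ^ j * g (0, j) * det (mat 3 3 (\<lambda>(i, k). g (Suc i, if k < j then k else Suc k))))"
    for g :: "nat \<times> nat \<Rightarrow> 'a"
    using det_mat_Suc[of 3 g] by simp
  have 5: "det (mat 5 5 f) =
      (\<Sum>j<5. (-1) ^ j * f (0, j) * det (mat 4 4 (\<lambda>(i, k). f (Suc i, if k < j then k else Suc k))))"
    using det_mat_Suc[of 4 f] by simp
  show ?thesis
    by (simp add: 5 4 det_mat_3 expand4 expand5 det5_def det3_def Let_def
          numeral_2_eq_2[symmetric],
        Groebner_Basis.algebra)
qed

text \<open>By multilinearity in the columns the left-hand side is a sum of determinants in which column \<open>j\<close> is
chosen among the columns \<open>j\<close> and \<open>j + 1\<close> of the coefficient matrix. A choice with a repeated column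
contributes nothing; what is left are the choices that omit a single column.\<close>

lemma det5_linear_forms:
  fixes p q r u v :: "nat \<Rightarrow> 'a::idom"
  shows "det5 (\<lambda>j. p j * x + p (Suc j) * y) (\<lambda>j. q j * x + q (Suc j) * y) (\<lambda>j. r j * x + r (Suc j) * y)
      (\<lambda>j. u j * x + u (Suc j) * y) (\<lambda>j. v j * x + v (Suc j) * y) 0 1 2 3 4 =
    (\<Sum>k\<le>5. maximal_minor p q r u v (5 - k) * x ^ (5 - k) * y ^ k)"
  by (simp add: atMost_nat_numeral atMost_Suc maximal_minor_def det5_def det3_def Let_def
        numeral_2_eq_2[symmetric],
      Groebner_Basis.algebra)

lemma maximal_minor_Const:
  "maximal_minor (\<lambda>k. Const (p k)) (\<lambda>k. Const (q k)) (\<lambda>k. Const (r k)) (\<lambda>k. Const (u k)) (\<lambda>k. Const (v k)) d =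
    Const (maximal_minor p q r u v d)"
  by (simp add: maximal_minor_def det5_def det3_def Let_def Const_add Const_diff Const_mult)

lemma maximal_minor_scale:
  fixes p q r u v :: "nat \<Rightarrow> 'a::idom"
  shows "maximal_minor (\<lambda>k. a * p k) (\<lambda>k. b * q k) (\<lambda>k. c * r k) (\<lambda>k. d * u k) (\<lambda>k. e * v k) n =
    a * b * c * d * e * maximal_minor p q r u v n"
  unfolding maximal_minor_def det5_def det3_def Let_def by Groebner_Basis.algebra

abbreviation linear_row :: "(nat \<Rightarrow> coeff_ring) \<Rightarrow> nat \<Rightarrow> form" where
  "linear_row A j \<equiv> Const (A j) * x1 + Const (A (Suc j)) * x2"

lemma wronskian_bform:
  "wronskian [bform 5 p, bform 5 q, bform 5 r, bform 5 u, bform 5 v] =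
    120 ^ 5 * pform 5 (\<lambda>k. maximal_minor p q r u v (5 - k))"
proof -
  have entry: "pdiff12 (4 - j) j (bform 5 A) = 120 * linear_row A j" if "j < 5" for A j
  proof -
    have "1 + (4 - j) + j = 5" using that by simp
    then have "pdiff12 (4 - j) j (bform 5 A) = scalar (fact 5 / fact 1) * bform 1 (\<lambda>k. A (k + j))"
      using pdiff12_bform[of "4 - j" j 1 A] by simp
    also have "scalar (fact 5 / fact 1) = 120"
      by (simp add: scalar_def fact_numeral Const_numeral)
    finally show ?thesis by (simp add: bform_def)
  qed
  let ?As = "[p, q, r, u, v]"
  have length: "length (map (bform 5) ?As) = 5"
    by simp
  have "mat 5 5 (\<lambda>(i, j). pdiff12 (5 - 1 - j) j (map (bform 5) ?As ! i)) =
      120 \<cdot>\<^sub>m mat 5 5 (\<lambda>(i, j). linear_row (?As ! i) j)"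
    by (rule eq_matI) (simp_all add: entry del: list.map)
  then have "wronskian (map (bform 5) ?As) = det (120 \<cdot>\<^sub>m mat 5 5 (\<lambda>(i, j). linear_row (?As ! i) j))"
    by (simp only: wronskian_def Let_def length)
  then have "wronskian [bform 5 p, bform 5 q, bform 5 r, bform 5 u, bform 5 v] =
      120 ^ 5 * det (mat 5 5 (\<lambda>(i, j). linear_row (?As ! i) j))"
    by (simp add: det_smult)
  also have "det (mat 5 5 (\<lambda>(i, j). linear_row (?As ! i) j)) =
      det5 (linear_row p) (linear_row q) (linear_row r) (linear_row u) (linear_row v) 0 1 2 3 4"
    by (simp add: det_mat_5)
  also have "\<dots> = pform 5 (\<lambda>k. maximal_minor p q r u v (5 - k))"
    using det5_linear_forms[where p = "\<lambda>k. Const (p k)" and q = "\<lambda>k. Const (q k)" and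
        r = "\<lambda>k. Const (r k)" and u = "\<lambda>k. Const (u k)" and v = "\<lambda>k. Const (v k)" and x = x1 and y = x2]
    by (simp only: maximal_minor_Const pform_def)
  finally show ?thesis .
qed

section \<open>The coefficients of the Wronskian of the quintic\<close>

text \<open>The coefficients of \<open>5 (x\<^sub>1\<^sup>2, F)\<^sub>1\<close>, \<open>10 (x\<^sub>1 x\<^sub>2, F)\<^sub>1\<close> and \<open>5 (x\<^sub>2\<^sup>2, F)\<^sub>1\<close>. These three forms span
the tangent space at \<open>F\<close> of its orbit under the special linear group.\<close>

definition sl2_row1 :: "coeff_ring list" where "sl2_row1 = [5*a1, 4*a2, 3*a3, 2*a4, a5, 0]"
definition sl2_row2 :: "coeff_ring list" where "sl2_row2 = [-5*a0, -3*a1, -a2, a3, 3*a4, 5*a5]"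
definition sl2_row3 :: "coeff_ring list" where "sl2_row3 = [0, -a0, -2*a1, -3*a2, -4*a3, -5*a4]"

abbreviation gamma_minor :: "(nat \<Rightarrow> coeff_ring) \<Rightarrow> (nat \<Rightarrow> coeff_ring) \<Rightarrow> nat \<Rightarrow> coeff_ring" where
  "gamma_minor \<equiv> maximal_minor ((!) sl2_row1) ((!) sl2_row2) ((!) sl2_row3)"

lemma sl2_forms:
  "5 * transvectant 2 5 1 (x1 ^ 2) quintic = bform 5 ((!) sl2_row1)"
  "10 * transvectant 2 5 1 (x1 * x2) quintic = bform 5 ((!) sl2_row2)"
  "5 * transvectant 2 5 1 (x2 ^ 2) quintic = bform 5 ((!) sl2_row3)"
proof -
  have 1: "x1 ^ 2 = bform 2 ((!) [1, 0, 0])" and 2: "2 * (x1 * x2) = bform 2 ((!) [0, 1, 0])"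
    and 3: "x2 ^ 2 = bform 2 ((!) [0, 0, 1])"
    by (simp_all add: form_expand)
  have "10 * transvectant 2 5 1 (x1 * x2) quintic = 5 * transvectant 2 5 1 (2 * (x1 * x2)) quintic"
    by (simp add: transvectant_numeral_left)
  also have "\<dots> = bform 5 ((!) sl2_row2)"
    unfolding 2 quintic_eq_bform
    by (simp add: transvectant_bform,
        simp add: form_expand quintic_coeffs_def sl2_row2_def,
        Groebner_Basis.algebra)
  finally show "10 * transvectant 2 5 1 (x1 * x2) quintic = bform 5 ((!) sl2_row2)" .
  show "5 * transvectant 2 5 1 (x1 ^ 2) quintic = bform 5 ((!) sl2_row1)"
    unfolding 1 quintic_eq_bform
    by (simp add: transvectant_bform,
        simp add: form_expand quintic_coeffs_def sl2_row1_def,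
        Groebner_Basis.algebra)
  show "5 * transvectant 2 5 1 (x2 ^ 2) quintic = bform 5 ((!) sl2_row3)"
    unfolding 3 quintic_eq_bform
    by (simp add: transvectant_bform,
        simp add: form_expand quintic_coeffs_def sl2_row3_def,
        Groebner_Basis.algebra)
qed

text \<open>The factor is \<open>120\<^sup>5 / (5 \<cdot> 10 \<cdot> 5 \<cdot> 15 \<cdot> 45)\<close>; the denominator undoes the integral rescaling of the
five rows.\<close>

lemma Gamma_eq:
  "Gamma_form (1/6, 2/45, -1/3) = 147456 * pform 5 (\<lambda>k. gamma_minor ((!) U_coeffs) ((!) V_coeffs) (5 - k))"
proof -
  have scale: "Const (1 / 5) * Const (1 / 10) * Const (1 / 5) * Const (1 / 15) * Const (1 / 45) =
      (Const (1 / 168750) :: coeff_ring)"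
    by (simp flip: Const_mult)
  have "Gamma_form (1/6, 2/45, -1/3) =
      120 ^ 5 * pform 5 (\<lambda>k. Const (1 / 168750) * gamma_minor ((!) U_coeffs) ((!) V_coeffs) (5 - k))"
    using sl2_forms[THEN bform_divide] U_eq[THEN bform_divide] V_eq[THEN bform_divide]
    by (simp only: Gamma_form.simps wronskian_bform maximal_minor_scale scale)
  also have "\<dots> = 120 ^ 5 * scalar (1 / 168750) * pform 5 (\<lambda>k. gamma_minor ((!) U_coeffs) ((!) V_coeffs) (5 - k))"
    by (simp add: pform_def scalar_def Const_mult sum_distrib_left mult_ac)
  also have "120 ^ 5 * scalar (1 / 168750) = scalar (120 ^ 5 * (1 / 168750))"
    by (simp only: scalar_def Const_mult Const_power Const_numeral)
  also have "\<dots> = 147456"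
    by (simp add: scalar_def Const_numeral)
  finally show ?thesis .
qed

text \<open>Under the infinitesimal shear the rows of \<open>u\<close> and \<open>v\<close> transform like coefficients of a covariant of
order 5, and so do the other three rows modulo each other. The maximal minors therefore
transform like the coefficients of a covariant of order 5, in reverse order.\<close>

lemma raise_gamma_minor:
  assumes "\<And>k. k \<le> 5 \<Longrightarrow> raise (u k) = of_nat (5 - k) * u (Suc k)"
    and "\<And>k. k \<le> 5 \<Longrightarrow> raise (v k) = of_nat (5 - k) * v (Suc k)"
    and d: "d < 5"
  shows "raise (gamma_minor u v (Suc d)) = of_nat (5 - d) * gamma_minor u v d"
proof -
  have row: "raise (w 0) = 5 * w (Suc 0)" "raise (w (Suc 0)) = 4 * w 2" "raise (w 2) = 3 * w 3"
    "raise (w 3) = 2 * w 4" "raise (w 4) = w 5" "raise (w 5) = 0"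
    if "\<And>k. k \<le> 5 \<Longrightarrow> raise (w k) = of_nat (5 - k) * w (Suc k)" for w
    using that[of 0] that[of 1] that[of 2] that[of 3] that[of 4] that[of 5]
    by (simp_all add: numeral_2_eq_2[symmetric])
  note row_u = row[of u, OF assms(1)] and row_v = row[of v, OF assms(2)]
  have minors: "raise (gamma_minor u v (Suc 0)) = 5 * gamma_minor u v 0"
    "raise (gamma_minor u v 2) = 4 * gamma_minor u v (Suc 0)"
    "raise (gamma_minor u v 3) = 3 * gamma_minor u v 2"
    "raise (gamma_minor u v 4) = 2 * gamma_minor u v 3"
    "raise (gamma_minor u v 5) = gamma_minor u v 4"
    by (simp_all add: maximal_minor_def det5_def det3_def Let_def sl2_row1_def sl2_row2_def
        sl2_row3_def numeral_2_eq_2[symmetric])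
      (simp_all add: raise.rules row_u row_v raise_vars, Groebner_Basis.algebra+)
  from d have "d = 0 \<or> d = 1 \<or> d = 2 \<or> d = 3 \<or> d = 4" by presburger
  then show ?thesis using minors by (elim disjE) (simp_all add: eval_nat_numeral)
qed

section \<open>Comparison with the derivatives of the Hermite invariant\<close>

text \<open>This is the one place where the covariants are multiplied out. The left-hand side is up to a
constant the leading coefficient of \<open>\<Gamma>\<close>, the coefficient of \<open>x\<^sub>1\<^sup>5\<close>. Among \<open>j\<^sub>0, j\<^sub>1, j\<^sub>2\<close> only the
last two depend on \<open>a\<^sub>5\<close>, and linearly, so differentiating before expanding keeps the right-hand side
small.\<close>

lemma leading_coefficient:
  "1001 * gamma_minor ((!) U_coeffs) ((!) V_coeffs) 5 = - 120 * pdiff 5 hermite_sum"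
proof -
  have d: "pdiff 5 a0 = 0" "pdiff 5 a1 = 0" "pdiff 5 a2 = 0" "pdiff 5 a3 = 0" "pdiff 5 a4 = 0" "pdiff 5 a5 = 1"
    by (simp_all add: pdiff_Var)
  have j: "pdiff 5 j0 = 0" "pdiff 5 j1 = a0" "pdiff 5 j2 = a1"
    by (simp_all add: j0_def j1_def j2_def pdiff.rules d)
  have expand: "(\<Sum>k\<le>14. f k) = f 0 + f (Suc 0) + f 2 + f 3 + f 4 + f 5 + f 6 + f 7 + f 8 + f 9 +
      f 10 + f 11 + f 12 + f 13 + f 14" for f :: "nat \<Rightarrow> coeff_ring"
    by (simp add: eval_nat_numeral)
  \<comment> \<open>The derivative is taken while \<open>j\<^sub>0, j\<^sub>1, j\<^sub>2\<close> are still symbols; only then are they replaced by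
    polynomials in the variables.\<close>
  show ?thesis
    by (simp add: hermite_sum_def expand hermite_weights_def seventh_power_coeffs_def
          quintic_coeffs_def th39_coeffs_def eval_nat_numeral,
        simp add: pdiff.rules d j,
        simp add: maximal_minor_def det5_def det3_def Let_def sl2_row1_def sl2_row2_def sl2_row3_def
          numeral_2_eq_2[symmetric],
        simp only: U_coeffs_def V_coeffs_def th33_coeffs_def th51_coeffs_def
          th22_sq_coeffs_def th26_coeffs_def e80_def disc_def Let_def,
        simp add: numeral_2_eq_2[symmetric],
        simp only: j0_def j1_def j2_def,
        Groebner_Basis.algebra)
qed

text \<open>Descending induction on \<open>d\<close>: applying \<open>raise\<close> to both sides of the equation for \<open>d + 1\<close> multiplies
both by \<open>5 - d\<close>, lowers the index, and changes the sign on the right.\<close>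

lemma minor_eq_derivative:
  assumes "d \<le> 5"
  shows "2 * gamma_minor ((!) U_coeffs) ((!) V_coeffs) d = 45 * (-1) ^ d * pdiff (of_nat d) hermite_invariant"
  using assms
proof (induction d rule: inc_induct)
  case base
  have "24024 * pdiff 5 hermite_invariant = 128 * pdiff 5 hermite_sum"
    using arg_cong[OF hermite_invariant_eq, of "pdiff 5"] by (simp add: pdiff.rules)
  \<comment> \<open>Eliminating the derivative of \<open>hermite_sum\<close> gives
    \<open>128 \<cdot> 1001 M\<^sub>5 = - 120 \<cdot> 24024 h\<^sub>5\<close>, which is \<open>64064\<close> times the claim.\<close>
  then have "64064 * (2 * gamma_minor ((!) U_coeffs) ((!) V_coeffs) 5) = 64064 * (- 45 * pdiff 5 hermite_invariant)"
    using leading_coefficient by Groebner_Basis.algebra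
  then show ?case by simp
next
  case (step d)
  let ?M = "gamma_minor ((!) U_coeffs) ((!) V_coeffs)"
  have "raise (?M (Suc d)) = of_nat (5 - d) * ?M d"
  proof (rule raise_gamma_minor)
    show "d < 5" by fact
    have "shear (bform 5 ((!) U_coeffs)) = 0" "shear (bform 5 ((!) V_coeffs)) = 0"
      by (simp_all add: shear.mult shear.numeral shear_U shear_V flip: U_eq V_eq)
    then show "raise (U_coeffs ! k) = of_nat (5 - k) * U_coeffs ! Suc k"
      "raise (V_coeffs ! k) = of_nat (5 - k) * V_coeffs ! Suc k" if "k \<le> 5" for k
      using that by (auto dest: covariant_coeffs)
  qed
  moreover have "raise (pdiff (of_nat (Suc d)) hermite_invariant) =
      - of_nat (5 - d) * pdiff (of_nat d) hermite_invariant"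
    by (rule raise_pdiff) (use step raise_hermite in auto)
  moreover have "raise (2 * ?M (Suc d)) =
      raise (45 * (-1) ^ Suc d * pdiff (of_nat (Suc d)) hermite_invariant)"
    using step.IH by (rule arg_cong)
  ultimately have "of_nat (5 - d) * (2 * ?M d) =
      of_nat (5 - d) * (45 * (-1) ^ d * pdiff (of_nat d) hermite_invariant)"
    by (simp add: raise.rules mult_ac del: of_nat_diff of_nat_Suc)
  then show ?case using step.hyps by (simp del: of_nat_diff)
qed

lemma ideal_generated_subset:
  assumes "\<And>s. s \<in> S \<Longrightarrow> \<exists>c. \<exists>t\<in>T. s = c * t"
  shows "ideal_generated S \<subseteq> ideal_generated T"
proof -
  interpret Modules.module "(*) :: 'a \<Rightarrow> 'a \<Rightarrow> 'a" by (rule module_times)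
  have "s \<in> span T" if "s \<in> S" for s
    using assms[OF that] by (auto intro: span_scale span_base)
  then show ?thesis
    unfolding ideal_generated_def by (intro span_minimal subsetI subspace_span)
qed

theorem corollary5p7:
  shows "jacobian_ideal hermite_invariant = b_ideal (1/6, 2/45, -1/3)"
proof
  let ?M = "gamma_minor ((!) U_coeffs) ((!) V_coeffs)"
  let ?G = "Gamma_form (1/6, 2/45, -1/3)"
  have lookup: "Poly_Mapping.lookup ?G e =
      (if Poly_Mapping.lookup e X1 + Poly_Mapping.lookup e X2 = 5
       then 147456 * ?M (5 - Poly_Mapping.lookup e X2) else 0)" for e
  proof -
    have "?G = pform 5 (\<lambda>k. 147456 * ?M (5 - k))"
      unfolding Gamma_eq by (simp add: pform_def Const_mult Const_numeral sum_distrib_left mult_ac)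
    then show ?thesis by (simp only: lookup_pform)
  qed
  let ?h = "\<lambda>d. pdiff (of_nat d) hermite_invariant"
  have proportional: "?h d = Const (2 * (-1) ^ d / 45) * ?M d" "?M d = Const (45 * (-1) ^ d / 2) * ?h d"
    if "d \<le> 5" for d
  proof -
    have h: "2 * ?M d = 45 * (-1) ^ d * ?h d" using minor_eq_derivative[OF that] .
    have 1: "Const ((-1) ^ d / 45) * (45 * (-1) ^ d) = (1 :: coeff_ring)"
      by (simp flip: Const_numeral Const_1 Const_uminus Const_power Const_mult power_add)
    have 2: "Const (1 / 2) * 2 = (1 :: coeff_ring)"
      by (simp flip: Const_numeral Const_1 Const_mult)
    have "?h d = Const ((-1) ^ d / 45) * (45 * (-1) ^ d) * ?h d" unfolding 1 by simp
    also have "\<dots> = Const ((-1) ^ d / 45) * (2 * ?M d)" unfolding h by (simp only: mult.assoc)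
    also have "\<dots> = Const (2 * (-1) ^ d / 45) * ?M d"
    proof -
      have "Const ((-1) ^ d / 45) * 2 = (Const (2 * (-1) ^ d / 45) :: coeff_ring)"
        by (simp add: mult.commute flip: Const_numeral Const_mult)
      then show ?thesis by (simp only: mult.assoc[symmetric])
    qed
    finally show "?h d = Const (2 * (-1) ^ d / 45) * ?M d" .
    have "?M d = Const (1 / 2) * 2 * ?M d" unfolding 2 by simp
    also have "\<dots> = Const (1 / 2) * (45 * (-1) ^ d * ?h d)" unfolding h[symmetric] by (simp only: mult.assoc)
    also have "\<dots> = Const (1 / 2 * (45 * (-1) ^ d)) * ?h d"
      by (simp only: Const_numeral Const_1 Const_uminus Const_power Const_mult mult.assoc)
    finally show "?M d = Const (45 * (-1) ^ d / 2) * ?h d" by simp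
  qed
  show "jacobian_ideal hermite_invariant \<subseteq> b_ideal (1/6, 2/45, -1/3)"
    unfolding jacobian_ideal_def b_ideal_def
  proof (rule ideal_generated_subset)
    fix s assume "s \<in> {pdiff i hermite_invariant | i. i \<in> UNIV}"
    then obtain d where "d < 6" and s: "s = ?h d"
      by (auto simp: UNIV_6)
    then have d: "d \<le> 5" by simp
    let ?e = "Poly_Mapping.single X1 d + Poly_Mapping.single X2 (5 - d)"
    have "Poly_Mapping.lookup ?G ?e = 147456 * ?M d"
      unfolding lookup using d by (simp add: lookup_add lookup_single)
    then have "s = Const (2 * (-1) ^ d / 45 / 147456) * Poly_Mapping.lookup ?G ?e"
      using proportional(1)[OF d] s
      by (simp del: Gamma_form.simps flip: Const_numeral Const_mult mult.assoc)
    then show "\<exists>c. \<exists>t\<in>{Poly_Mapping.lookup ?G m | m. m \<in> UNIV}. s = c * t"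
      by blast
  qed
  show "b_ideal (1/6, 2/45, -1/3) \<subseteq> jacobian_ideal hermite_invariant"
    unfolding jacobian_ideal_def b_ideal_def
  proof (rule ideal_generated_subset)
    fix s assume "s \<in> {Poly_Mapping.lookup ?G m | m. m \<in> UNIV}"
    then obtain e where e: "s = Poly_Mapping.lookup ?G e" by blast
    have "\<exists>c d. s = c * ?h d"
    proof (cases "Poly_Mapping.lookup e X1 + Poly_Mapping.lookup e X2 = 5")
      case True
      then have "s = 147456 * Const (45 * (-1) ^ (5 - Poly_Mapping.lookup e X2) / 2) *
          ?h (5 - Poly_Mapping.lookup e X2)"
        unfolding e lookup using proportional(2)[of "5 - Poly_Mapping.lookup e X2"]
        by (simp add: mult.assoc)
      then show ?thesis by blast
    next
      case False
      then have "s = 0 * ?h 0" unfolding e lookup by simp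
      then show ?thesis by blast
    qed
    then show "\<exists>c. \<exists>t\<in>{pdiff i hermite_invariant | i. i \<in> UNIV}. s = c * t"
      by blast
  qed
qed

end
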